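(* Let $s\ge 2$ be an integer. Then there exist pseudo-Riemannian manifolds $(M,g)$ of signature $(2s,s)$ which are spacelike Jordan Osserman and nilpotent Osserman of order $3$, and which are not timelike Jordan Osserman.
   Context: Signature $(p,q)$ means that $p$ is the dimension of a maximal negative definite (timelike) subspace and $q$ the dimension of a maximal positive definite (spacelike) subspace of each tangent space; so $\dim M=p+q$. Let $(M,g)$ be a pseudo-Riemannian manifold of signature $(p,q)$ with Levi-Civita connection $\nabla$ and curvature tensor $R(x,y,z,w)=g((\nabla_x\nabla_y-\nabla_y\nabla_x-\nabla_{[x,y]})z,w)$. For $x\in T_PM$ the Jacobi operator $J(x)$ is the self-adjoint linear map of $T_PM$ characterized by $g(J(x)y,z)=R(y,x,x,z)$ for all $y,z\in T_PM$. Let $S^{\pm}(M,g)=\{x\in TM: g(x,x)=\pm1\}$ be the bundles of unit spacelike ($+$) and unit timelike ($-$) vectors. $(M,g)$ is spacelike (resp. timelike) Jordan Osserman if the Jordan normal form of $J(x)$ is the same for all $x\in S^+(M,g)$ (resp. all $x\in S^-(M,g)$). $(M,g)$ is nilpotent Osserman if $J(x)^{p+q}=0$ for all $x\in TM$. In that case the order of nilpotency $n(x)$ is the positive integer with $J(x)^{n(x)}=0$ and $J(x)^{n(x)-1}\ne0$ (where $J(x)^0=\mathrm{id}$), and $n(M):=\sup_{x\in TM}n(x)$. Nilpotent of order $3$ means $n(M)=3$. *)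

theory Defs
  imports
    "HOL-Analysis.Analysis"
    "HOL-Library.Function_Algebras"
    "Jordan_Normal_Form.Jordan_Normal_Form"
begin

instantiation "fun" :: (type, real_vector) real_vector
begin

definition "r *\<^sub>R f = (\<lambda>x. r *\<^sub>R f x)"

instance
  by standard (simp_all add: scaleR_fun_def fun_eq_iff scaleR_add_right scaleR_add_left)

end

text \<open>
  The model space is \<^term>\<open>Euclidean_space n\<close>, the set of all \<^term>\<open>x :: nat \<Rightarrow> real\<close> with
  \<^prop>\<open>\<forall>i\<ge>n. x i = 0\<close>, so that the dimension is an ordinary natural number.
\<close>

definition partial_deriv :: "nat \<Rightarrow> ((nat \<Rightarrow> real) \<Rightarrow> real) \<Rightarrow> (nat \<Rightarrow> real) \<Rightarrow> real" where
  "partial_deriv i f x = deriv (\<lambda>t. f (x(i := t))) (x i)"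

text \<open>\<open>U\<close> is always an open subset of \<^term>\<open>Euclidean_space n\<close>.\<close>

primrec Ck_on :: "nat \<Rightarrow> (nat \<Rightarrow> real) set \<Rightarrow> nat \<Rightarrow> ((nat \<Rightarrow> real) \<Rightarrow> real) \<Rightarrow> bool" where
  "Ck_on n U 0 f \<longleftrightarrow> continuous_map (subtopology (Euclidean_space n) U) euclideanreal f"
| "Ck_on n U (Suc k) f \<longleftrightarrow>
     continuous_map (subtopology (Euclidean_space n) U) euclideanreal f \<and>
     (\<forall>i<n. (\<forall>x\<in>U. (\<lambda>t. f (x(i := t))) differentiable at (x i)) \<and>
            Ck_on n U k (partial_deriv i f))"

definition smooth_on :: "nat \<Rightarrow> (nat \<Rightarrow> real) set \<Rightarrow> ((nat \<Rightarrow> real) \<Rightarrow> real) \<Rightarrow> bool" where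
  "smooth_on n U f \<longleftrightarrow> (\<forall>k. Ck_on n U k f)"

text \<open>
  A chart is a pair of its domain and its coordinate map; values of the coordinate map outside
  the domain are irrelevant. The atlas need not be maximal.
\<close>

record 'a manifold =
  mtop :: "'a topology"
  mdim :: nat
  matlas :: "('a set \<times> ('a \<Rightarrow> nat \<Rightarrow> real)) set"

abbreviation points :: "'a manifold \<Rightarrow> 'a set" where
  "points M \<equiv> topspace (mtop M)"

definition smooth_manifold :: "'a manifold \<Rightarrow> bool" where
  "smooth_manifold M \<longleftrightarrow>
     Hausdorff_space (mtop M) \<and> second_countable (mtop M) \<and>
     (\<Union>(U, \<phi>)\<in>matlas M. U) = points M \<and>
     (\<forall>(U, \<phi>)\<in>matlas M.
        openin (mtop M) U \<and> openin (Euclidean_space (mdim M)) (\<phi> ` U) \<and>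
        homeomorphic_map (subtopology (mtop M) U)
          (subtopology (Euclidean_space (mdim M)) (\<phi> ` U)) \<phi>) \<and>
     (\<forall>(U, \<phi>)\<in>matlas M. \<forall>(V, \<psi>)\<in>matlas M. \<forall>i<mdim M.
        smooth_on (mdim M) (\<phi> ` (U \<inter> V)) (\<lambda>x. \<psi> (inv_into U \<phi> x) i))"

text \<open>
  Functions on the manifold are total on the underlying type and normalised to vanish off
  \<^term>\<open>points M\<close>; likewise tangent vectors vanish on non-smooth functions and vector fields
  vanish off \<^term>\<open>points M\<close>. This makes the objects below unique as HOL functions.
\<close>

definition smooth_functions :: "'a manifold \<Rightarrow> ('a \<Rightarrow> real) set" where
  "smooth_functions M =
     {f. (\<forall>p. p \<notin> points M \<longrightarrow> f p = 0) \<and>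
         (\<forall>(U, \<phi>)\<in>matlas M. smooth_on (mdim M) (\<phi> ` U) (\<lambda>x. f (inv_into U \<phi> x)))}"

text \<open>Tangent vectors at \<open>p\<close> are the derivations at \<open>p\<close> of the algebra of smooth functions.\<close>

type_synonym 'a tvec = "('a \<Rightarrow> real) \<Rightarrow> real"
type_synonym 'a vfield = "'a \<Rightarrow> 'a tvec"

definition tangent_space :: "'a manifold \<Rightarrow> 'a \<Rightarrow> 'a tvec set" where
  "tangent_space M p =
     {v. (\<forall>f. f \<notin> smooth_functions M \<longrightarrow> v f = 0) \<and>
         (\<forall>f\<in>smooth_functions M. \<forall>h\<in>smooth_functions M.
            v (f + h) = v f + v h \<and> v (f * h) = f p * v h + h p * v f) \<and>
         (\<forall>c. \<forall>f\<in>smooth_functions M. v (c *\<^sub>R f) = c * v f)}"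

definition vector_fields :: "'a manifold \<Rightarrow> 'a vfield set" where
  "vector_fields M =
     {X. (\<forall>p\<in>points M. X p \<in> tangent_space M p) \<and> (\<forall>p. p \<notin> points M \<longrightarrow> X p = 0) \<and>
         (\<forall>f\<in>smooth_functions M. (\<lambda>p. X p f) \<in> smooth_functions M)}"

definition fmult :: "('a \<Rightarrow> real) \<Rightarrow> 'a vfield \<Rightarrow> 'a vfield" where
  "fmult f X = (\<lambda>p. f p *\<^sub>R X p)"

definition lie_bracket :: "'a manifold \<Rightarrow> 'a vfield \<Rightarrow> 'a vfield \<Rightarrow> 'a vfield" where
  "lie_bracket M X Y = (\<lambda>p f. if f \<in> smooth_functions M
     then X p (\<lambda>q. Y q f) - Y p (\<lambda>q. X q f) else 0)"

type_synonym 'a metric_tensor = "'a \<Rightarrow> 'a tvec \<Rightarrow> 'a tvec \<Rightarrow> real"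

definition metric_fun :: "'a manifold \<Rightarrow> 'a metric_tensor \<Rightarrow> 'a vfield \<Rightarrow> 'a vfield \<Rightarrow> 'a \<Rightarrow> real" where
  "metric_fun M g X Y = (\<lambda>p. if p \<in> points M then g p (X p) (Y p) else 0)"

definition pseudo_riemannian_manifold :: "'a manifold \<Rightarrow> 'a metric_tensor \<Rightarrow> bool" where
  "pseudo_riemannian_manifold M g \<longleftrightarrow>
     smooth_manifold M \<and>
     (\<forall>p\<in>points M. \<forall>x\<in>tangent_space M p. \<forall>y\<in>tangent_space M p.
        g p x y = g p y x \<and>
        (\<forall>z\<in>tangent_space M p. g p (x + y) z = g p x z + g p y z) \<and>
        (\<forall>c. g p (c *\<^sub>R x) y = c * g p x y)) \<and>
     (\<forall>p\<in>points M. \<forall>x\<in>tangent_space M p. (\<forall>y\<in>tangent_space M p. g p x y = 0) \<longrightarrow> x = 0) \<and>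
     (\<forall>X\<in>vector_fields M. \<forall>Y\<in>vector_fields M. metric_fun M g X Y \<in> smooth_functions M)"

definition max_subspace_dim :: "'v::real_vector set \<Rightarrow> ('v set \<Rightarrow> bool) \<Rightarrow> nat \<Rightarrow> bool" where
  "max_subspace_dim T P d \<longleftrightarrow>
     (\<exists>V. subspace V \<and> V \<subseteq> T \<and> P V \<and> dim V = d) \<and>
     (\<forall>V. subspace V \<and> V \<subseteq> T \<and> P V \<longrightarrow> dim V \<le> d)"

text \<open>In signature \<open>(p, q)\<close>, \<open>p\<close> counts the negative (timelike) directions.\<close>

definition has_signature :: "'a manifold \<Rightarrow> 'a metric_tensor \<Rightarrow> nat \<times> nat \<Rightarrow> bool" where
  "has_signature M g = (\<lambda>(p, q). \<forall>P\<in>points M.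
     max_subspace_dim (tangent_space M P) (\<lambda>V. \<forall>v\<in>V. v \<noteq> 0 \<longrightarrow> g P v v < 0) p \<and>
     max_subspace_dim (tangent_space M P) (\<lambda>V. \<forall>v\<in>V. v \<noteq> 0 \<longrightarrow> g P v v > 0) q)"

type_synonym 'a connection = "'a vfield \<Rightarrow> 'a vfield \<Rightarrow> 'a vfield"

definition affine_connection :: "'a manifold \<Rightarrow> 'a connection \<Rightarrow> bool" where
  "affine_connection M D \<longleftrightarrow>
     (\<forall>X Y. X \<notin> vector_fields M \<or> Y \<notin> vector_fields M \<longrightarrow> D X Y = 0) \<and>
     (\<forall>X\<in>vector_fields M. \<forall>Y\<in>vector_fields M.
        D X Y \<in> vector_fields M \<and>
        (\<forall>Z\<in>vector_fields M. D (X + Z) Y = D X Y + D Z Y \<and> D X (Y + Z) = D X Y + D X Z) \<and>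
        (\<forall>f\<in>smooth_functions M.
           D (fmult f X) Y = fmult f (D X Y) \<and>
           D X (fmult f Y) = fmult (\<lambda>p. X p f) Y + fmult f (D X Y)))"

definition is_levi_civita :: "'a manifold \<Rightarrow> 'a metric_tensor \<Rightarrow> 'a connection \<Rightarrow> bool" where
  "is_levi_civita M g D \<longleftrightarrow>
     affine_connection M D \<and>
     (\<forall>X\<in>vector_fields M. \<forall>Y\<in>vector_fields M. D X Y - D Y X = lie_bracket M X Y) \<and>
     (\<forall>X\<in>vector_fields M. \<forall>Y\<in>vector_fields M. \<forall>Z\<in>vector_fields M. \<forall>p\<in>points M.
        X p (metric_fun M g Y Z) = g p (D X Y p) (Z p) + g p (Y p) (D X Z p))"

definition levi_civita :: "'a manifold \<Rightarrow> 'a metric_tensor \<Rightarrow> 'a connection" where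
  "levi_civita M g = (THE D. is_levi_civita M g D)"

definition curvature_operator ::
    "'a manifold \<Rightarrow> 'a metric_tensor \<Rightarrow> 'a vfield \<Rightarrow> 'a vfield \<Rightarrow> 'a vfield \<Rightarrow> 'a vfield" where
  "curvature_operator M g X Y Z =
     (let D = levi_civita M g in D X (D Y Z) - D Y (D X Z) - D (lie_bracket M X Y) Z)"

text \<open>
  The curvature tensor at \<open>p\<close> is evaluated on tangent vectors through arbitrary extensions to
  vector fields; by tensoriality the value does not depend on them.
\<close>

definition curvature ::
    "'a manifold \<Rightarrow> 'a metric_tensor \<Rightarrow> 'a \<Rightarrow> 'a tvec \<Rightarrow> 'a tvec \<Rightarrow> 'a tvec \<Rightarrow> 'a tvec \<Rightarrow> real" where
  "curvature M g p x y z w = (THE r.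
     \<forall>X\<in>vector_fields M. \<forall>Y\<in>vector_fields M. \<forall>Z\<in>vector_fields M. \<forall>W\<in>vector_fields M.
       X p = x \<and> Y p = y \<and> Z p = z \<and> W p = w \<longrightarrow>
       r = g p (curvature_operator M g X Y Z p) (W p))"

definition jacobi :: "'a manifold \<Rightarrow> 'a metric_tensor \<Rightarrow> 'a \<Rightarrow> 'a tvec \<Rightarrow> 'a tvec \<Rightarrow> 'a tvec" where
  "jacobi M g p x y = (THE v. v \<in> tangent_space M p \<and>
     (\<forall>z\<in>tangent_space M p. g p v z = curvature M g p y x x z))"

text \<open>
  Jordan normal forms are taken over the complex numbers, i.e. for the complexification of the
  real operator. The list \<open>n_as\<close> gives the blocks as (size, eigenvalue) pairs; it is determined up
  to reordering.
\<close>

definition has_jordan_form ::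
    "'v::real_vector set \<Rightarrow> ('v \<Rightarrow> 'v) \<Rightarrow> (nat \<times> complex) list \<Rightarrow> bool" where
  "has_jordan_form V T n_as \<longleftrightarrow>
     (\<exists>bs A. distinct bs \<and> independent (set bs) \<and> span (set bs) = V \<and>
        A \<in> carrier_mat (length bs) (length bs) \<and>
        (\<forall>j<length bs. T (bs ! j) = (\<Sum>i<length bs. (A $$ (i, j)) *\<^sub>R (bs ! i))) \<and>
        jordan_nf (map_mat complex_of_real A) n_as)"

definition spacelike_jordan_osserman :: "'a manifold \<Rightarrow> 'a metric_tensor \<Rightarrow> bool" where
  "spacelike_jordan_osserman M g \<longleftrightarrow>
     (\<exists>n_as. \<forall>p\<in>points M. \<forall>x\<in>tangent_space M p.
        g p x x = 1 \<longrightarrow> has_jordan_form (tangent_space M p) (jacobi M g p x) n_as)"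

definition timelike_jordan_osserman :: "'a manifold \<Rightarrow> 'a metric_tensor \<Rightarrow> bool" where
  "timelike_jordan_osserman M g \<longleftrightarrow>
     (\<exists>n_as. \<forall>p\<in>points M. \<forall>x\<in>tangent_space M p.
        g p x x = -1 \<longrightarrow> has_jordan_form (tangent_space M p) (jacobi M g p x) n_as)"

definition jacobi_power_zero ::
    "'a manifold \<Rightarrow> 'a metric_tensor \<Rightarrow> 'a \<Rightarrow> 'a tvec \<Rightarrow> nat \<Rightarrow> bool" where
  "jacobi_power_zero M g p x k \<longleftrightarrow> (\<forall>y\<in>tangent_space M p. (jacobi M g p x ^^ k) y = 0)"

definition nilpotent_osserman :: "'a manifold \<Rightarrow> 'a metric_tensor \<Rightarrow> bool" where
  "nilpotent_osserman M g \<longleftrightarrow>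
     (\<forall>p\<in>points M. \<forall>x\<in>tangent_space M p. jacobi_power_zero M g p x (mdim M))"

definition nilpotency_order :: "'a manifold \<Rightarrow> 'a metric_tensor \<Rightarrow> 'a \<Rightarrow> 'a tvec \<Rightarrow> nat" where
  "nilpotency_order M g p x =
     (THE k. k > 0 \<and> jacobi_power_zero M g p x k \<and> \<not> jacobi_power_zero M g p x (k - 1))"

text \<open>The supremum is over a set bounded by \<^term>\<open>mdim M\<close> when \<open>M\<close> is nilpotent Osserman.\<close>

definition manifold_nilpotency_order :: "'a manifold \<Rightarrow> 'a metric_tensor \<Rightarrow> nat" where
  "manifold_nilpotency_order M g =
     (SUP (p, x)\<in>Sigma (points M) (tangent_space M). nilpotency_order M g p x)"

definition nilpotent_osserman_of_order :: "'a manifold \<Rightarrow> 'a metric_tensor \<Rightarrow> nat \<Rightarrow> bool" where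
  "nilpotent_osserman_of_order M g k \<longleftrightarrow>
     nilpotent_osserman M g \<and> manifold_nilpotency_order M g = k"

end

theory Submission
  imports Defs "Jordan_Normal_Form.Jordan_Normal_Form_Existence"
begin

text \<open>
The example is \<open>R^(3s)\<close> with coordinates \<open>(u, t, v)\<close>, three blocks of length \<open>s\<close>, and the metric
\<open>2 \<Sum> du_i dv_i - \<Sum> dt_i^2 - 2 (\<Sum> u_k t_k) \<Sum> du_i^2\<close>. At each point the first and last summand form a
neutral metric on the \<open>u\<close> and \<open>v\<close> directions, so the signature is \<open>(2s, s)\<close>.

All the algebra comes from one computation. For a tangent vector \<open>x = (a, b, c)\<close>, put \<open>N = |a|^2\<close>. The
Jacobi operator \<open>J(x)\<close> sends the \<open>u\<close> block into the \<open>t\<close> and \<open>v\<close> blocks, the \<open>t\<close> block into the \<open>v\<close>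
block, and the \<open>v\<close> block to \<open>0\<close> (\<open>jacobi_form\<close>); hence \<open>J(x)^3 = 0\<close>. On a vector with \<open>u\<close> part
\<open>\<alpha>\<close>, the \<open>t\<close> part of \<open>J(x)\<close> is \<open>- (N \<alpha> - \<langle>a, \<alpha>\<rangle> a)\<close> and \<open>J(x)^2\<close> is \<open>N\<close> times the same vector,
placed in the \<open>v\<close> block. So up to the factors \<open>-N\<close> and \<open>-N^2\<close>, both act as the orthogonal
projection onto the complement of \<open>a\<close>, and the dimension of this complement determines the Jordan type.

If \<open>x\<close> is spacelike then \<open>a \<noteq> 0\<close>, since \<open>a = 0\<close> gives \<open>g(x, x) = - |b|^2\<close>. An orthogonal complement of
\<open>a\<close> then starts \<open>s - 1\<close> Jordan chains of length \<open>3\<close>, and \<open>x\<close>, \<open>(0, a, 0)\<close>, \<open>(0, 0, a)\<close> complete them to a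
basis by three vectors of the kernel. In this basis \<open>J(x)\<close> has a matrix depending on \<open>s\<close> alone
(\<open>jacobi_shift\<close>), which is the spacelike Jordan Osserman property. A timelike vector may have
\<open>a = 0\<close>, and then \<open>J(x) = 0\<close>, or \<open>a \<noteq> 0\<close>, and then \<open>J(x) \<noteq> 0\<close> because the complement of \<open>a\<close> is
nontrivial for \<open>s \<ge> 2\<close>. This excludes the timelike property, and the same nontriviality gives
\<open>J(x)^2 \<noteq> 0\<close> for some \<open>x\<close>.

The larger part of the work is to reach this computation from the coordinate-free definitions.
Tangent vectors are derivations of the algebra of smooth functions; Hadamard's lemma shows that they
are determined by their values on the coordinate functions (\<open>tangent_expand\<close>), so vector fields become
tuples of smooth functions. The Levi-Civita connection is the flat derivative plus an explicit bilinear
term; it is recognised by the defining properties and by their uniqueness (\<open>levi_civita_unique\<close>),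
without solving the Koszul formula. Its curvature is then a polynomial expression in that
bilinear term and its derivative (\<open>jacobi_coord\<close>).
\<close>

section \<open>Smooth functions on Euclidean space\<close>

type_synonym vect = "nat \<Rightarrow> real"

abbreviation E :: "nat \<Rightarrow> vect set" where
  "E n \<equiv> topspace (Euclidean_space n)"

abbreviation smooth :: "nat \<Rightarrow> (vect \<Rightarrow> real) \<Rightarrow> bool" where
  "smooth n \<equiv> smooth_on n (E n)"

lemma E_iff: "x \<in> E n \<longleftrightarrow> (\<forall>i\<ge>n. x i = 0)"
  by (simp add: topspace_Euclidean_space)

lemma E_upd: "x \<in> E n \<Longrightarrow> i < n \<Longrightarrow> x(i := t) \<in> E n"
  by (auto simp: E_iff)

lemma continuous_map_E: "continuous_map (Euclidean_space n) euclideanreal f \<longleftrightarrow> continuous_on (E n) f"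
proof -
  have "Euclidean_space n = subtopology euclidean (E n)"
    by (simp add: Euclidean_space_def euclidean_product_topology)
  then show ?thesis
    by (metis continuous_map_iff_continuous)
qed

lemma Ck_on_E_0: "Ck_on n (E n) 0 f \<longleftrightarrow> continuous_on (E n) f"
  by (simp add: continuous_map_E)

lemma Ck_on_E_Suc: "Ck_on n (E n) (Suc k) f \<longleftrightarrow> continuous_on (E n) f \<and>
    (\<forall>i<n. (\<forall>x\<in>E n. (\<lambda>t. f (x(i := t))) differentiable at (x i)) \<and>
      Ck_on n (E n) k (partial_deriv i f))"
  by (simp add: continuous_map_E)

lemma partial_deriv_eq:
  "((\<lambda>t. f (x(i := t))) has_real_derivative d) (at (x i)) \<Longrightarrow> partial_deriv i f x = d"
  by (simp add: partial_deriv_def DERIV_imp_deriv)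

lemma partial_deriv_cong:
  assumes "\<And>x. x \<in> E n \<Longrightarrow> f x = g x" "x \<in> E n" "i < n"
  shows "partial_deriv i f x = partial_deriv i g x"
proof -
  have "(\<lambda>t. f (x(i := t))) = (\<lambda>t. g (x(i := t)))"
    using assms by (intro ext assms(1) E_upd)
  then show ?thesis
    by (simp add: partial_deriv_def)
qed

lemma Ck_on_cong:
  assumes "\<And>x. x \<in> E n \<Longrightarrow> f x = g x"
  shows "Ck_on n (E n) k f \<longleftrightarrow> Ck_on n (E n) k g"
  using assms
proof (induction k arbitrary: f g)
  case 0
  then show ?case
    by (simp add: Ck_on_E_0 del: Ck_on.simps cong: continuous_on_cong)
next
  case (Suc k)
  have "(\<lambda>t. f (x(i := t))) = (\<lambda>t. g (x(i := t)))" if "x \<in> E n" "i < n" for x i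
    using that by (intro ext Suc.prems E_upd)
  moreover have "Ck_on n (E n) k (partial_deriv i f) \<longleftrightarrow> Ck_on n (E n) k (partial_deriv i g)"
    if "i < n" for i
    using Suc.prems that by (intro Suc.IH partial_deriv_cong) auto
  moreover have "continuous_on (E n) f \<longleftrightarrow> continuous_on (E n) g"
    using Suc.prems by (intro continuous_on_cong) auto
  ultimately show ?case
    unfolding Ck_on_E_Suc by (intro conj_cong all_cong1 imp_cong ball_cong refl) simp_all
qed

lemma smooth_cong:
  assumes "\<And>x. x \<in> E n \<Longrightarrow> f x = g x"
  shows "smooth n f \<longleftrightarrow> smooth n g"
  using Ck_on_cong[OF assms] by (simp add: smooth_on_def)

lemma smooth_continuous: "smooth n f \<Longrightarrow> continuous_on (E n) f"
  using Ck_on_E_0 unfolding smooth_on_def by blast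

lemma smooth_partial: "smooth n f \<Longrightarrow> i < n \<Longrightarrow> smooth n (partial_deriv i f)"
  using Ck_on_E_Suc unfolding smooth_on_def by blast

lemma smooth_has_partial:
  assumes "smooth n f" "i < n" "x \<in> E n"
  shows "((\<lambda>t. f (x(i := t))) has_real_derivative partial_deriv i f x) (at (x i))"
proof -
  have "Ck_on n (E n) (Suc 0) f"
    using assms(1) unfolding smooth_on_def by blast
  then have "(\<lambda>t. f (x(i := t))) differentiable at (x i)"
    using assms(2,3) unfolding Ck_on_E_Suc by blast
  then show ?thesis
    by (simp add: partial_deriv_def DERIV_deriv_iff_real_differentiable)
qed

lemma smooth_has_partial_at:
  assumes "smooth n f" "i < n" "x \<in> E n"
  shows "((\<lambda>t. f (x(i := t))) has_real_derivative partial_deriv i f (x(i := u))) (at u)"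
  using smooth_has_partial[OF assms(1,2), of "x(i := u)"] assms by (simp add: E_upd)

text \<open>
Smoothness is the greatest class of continuous functions stable under partial derivatives. This makes
it possible to prove smoothness of a whole family at once, when the derivatives of its members are
again members, instead of inducting on the order of differentiability.
\<close>

lemma smooth_coinduct [consumes 1]:
  assumes "P f"
    and cont: "\<And>f. P f \<Longrightarrow> continuous_on (E n) f"
    and step: "\<And>f i. P f \<Longrightarrow> i < n \<Longrightarrow> \<exists>g. P g \<and>
       (\<forall>x\<in>E n. ((\<lambda>t. f (x(i := t))) has_real_derivative g x) (at (x i)))"
  shows "smooth n f"
proof -
  have "Ck_on n (E n) k f" if "P f" for k f
    using that
  proof (induction k arbitrary: f)
    case 0
    then show ?case
      using cont by (simp add: Ck_on_E_0 del: Ck_on.simps)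
  next
    case (Suc k)
    have "(\<forall>x\<in>E n. (\<lambda>t. f (x(i := t))) differentiable at (x i)) \<and>
        Ck_on n (E n) k (partial_deriv i f)" if i: "i < n" for i
    proof -
      obtain g where g: "P g"
        "\<And>x. x \<in> E n \<Longrightarrow> ((\<lambda>t. f (x(i := t))) has_real_derivative g x) (at (x i))"
        using step[OF Suc.prems i] by blast
      have "Ck_on n (E n) k (partial_deriv i f) \<longleftrightarrow> Ck_on n (E n) k g"
        by (intro Ck_on_cong partial_deriv_eq g)
      then show ?thesis
        using g Suc.IH by (auto simp: real_differentiable_def)
    qed
    then show ?case
      using cont[OF Suc.prems] by (simp only: Ck_on_E_Suc) blast
  qed
  then show ?thesis
    using assms(1) by (simp add: smooth_on_def)
qed

lemma smooth_const: "smooth n (\<lambda>x. c)"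
proof (rule smooth_coinduct[where P = "\<lambda>f. \<exists>c. f = (\<lambda>x. c)"])
  fix f :: "vect \<Rightarrow> real" and i
  assume "\<exists>c. f = (\<lambda>x. c)"
  then show "\<exists>g. (\<exists>c. g = (\<lambda>x. c)) \<and>
     (\<forall>x\<in>E n. ((\<lambda>t. f (x(i := t))) has_real_derivative g x) (at (x i)))"
    by (intro exI[of _ "\<lambda>x. 0"]) auto
qed auto

lemma continuous_on_coordinate: "continuous_on S (\<lambda>x :: nat \<Rightarrow> real. x i)"
  by (rule continuous_on_subset[OF continuous_on_product_coordinates]) simp

lemma smooth_coord: "smooth n (\<lambda>x. x j)"
proof (rule smooth_coinduct[where P = "\<lambda>f. f = (\<lambda>x. x j) \<or> (\<exists>c. f = (\<lambda>x. c))"])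
  fix f :: "vect \<Rightarrow> real" and i
  assume "f = (\<lambda>x. x j) \<or> (\<exists>c. f = (\<lambda>x. c))" "i < n"
  then show "\<exists>g. (g = (\<lambda>x. x j) \<or> (\<exists>c. g = (\<lambda>x. c))) \<and>
     (\<forall>x\<in>E n. ((\<lambda>t. f (x(i := t))) has_real_derivative g x) (at (x i)))"
    by (intro exI[of _ "\<lambda>x. if f = (\<lambda>x. x j) \<and> i = j then 1 else 0"])
       (auto intro!: derivative_eq_intros)
qed (auto intro!: continuous_on_coordinate)

text \<open>
Products are treated by induction on the order: the Leibniz rule multiplies a derivative by a function
that has to be regarded as once less differentiable than assumed.
\<close>

lemma Ck_on_Suc_imp: "Ck_on n (E n) (Suc k) f \<Longrightarrow> Ck_on n (E n) k f"
proof (induction k arbitrary: f)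
  case (Suc k)
  then show ?case
    by (subst Ck_on_E_Suc, subst (asm) (2) Ck_on_E_Suc) blast
qed (simp only: Ck_on_E_0 Ck_on_E_Suc)

lemma Ck_on_add:
  assumes "Ck_on n (E n) k f" "Ck_on n (E n) k g"
  shows "Ck_on n (E n) k (\<lambda>x. f x + g x)"
  using assms
proof (induction k arbitrary: f g)
  case 0
  then show ?case
    by (simp only: Ck_on_E_0) (intro continuous_intros)
next
  case (Suc k)
  have "(\<forall>x\<in>E n. (\<lambda>t. f (x(i := t)) + g (x(i := t))) differentiable at (x i)) \<and>
      Ck_on n (E n) k (partial_deriv i (\<lambda>x. f x + g x))" if i: "i < n" for i
  proof -
    have d: "((\<lambda>t. f (x(i := t)) + g (x(i := t))) has_real_derivative
        partial_deriv i f x + partial_deriv i g x) (at (x i))" if "x \<in> E n" for x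
      using Suc.prems i that unfolding Ck_on_E_Suc partial_deriv_def
      by (intro DERIV_add) (auto simp: DERIV_deriv_iff_real_differentiable)
    have "Ck_on n (E n) k (partial_deriv i (\<lambda>x. f x + g x)) \<longleftrightarrow>
        Ck_on n (E n) k (\<lambda>x. partial_deriv i f x + partial_deriv i g x)"
      by (intro Ck_on_cong partial_deriv_eq d)
    moreover have "Ck_on n (E n) k (\<lambda>x. partial_deriv i f x + partial_deriv i g x)"
      using Suc.prems i by (intro Suc.IH) (simp_all only: Ck_on_E_Suc)
    ultimately show ?thesis
      using d by (auto simp: real_differentiable_def)
  qed
  then show ?case
    using Suc.prems by (simp only: Ck_on_E_Suc) (auto intro!: continuous_intros)
qed

lemma Ck_on_mult:
  assumes "Ck_on n (E n) k f" "Ck_on n (E n) k g"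
  shows "Ck_on n (E n) k (\<lambda>x. f x * g x)"
  using assms
proof (induction k arbitrary: f g)
  case 0
  then show ?case
    by (simp only: Ck_on_E_0) (intro continuous_intros)
next
  case (Suc k)
  have "(\<forall>x\<in>E n. (\<lambda>t. f (x(i := t)) * g (x(i := t))) differentiable at (x i)) \<and>
      Ck_on n (E n) k (partial_deriv i (\<lambda>x. f x * g x))" if i: "i < n" for i
  proof -
    have d: "((\<lambda>t. f (x(i := t)) * g (x(i := t))) has_real_derivative
        f x * partial_deriv i g x + partial_deriv i f x * g x) (at (x i))" if "x \<in> E n" for x
    proof -
      have "((\<lambda>t. f (x(i := t))) has_real_derivative partial_deriv i f x) (at (x i))"
        "((\<lambda>t. g (x(i := t))) has_real_derivative partial_deriv i g x) (at (x i))"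
        using Suc.prems i that unfolding Ck_on_E_Suc partial_deriv_def
        by (auto simp: DERIV_deriv_iff_real_differentiable)
      from DERIV_mult'[OF this] show ?thesis
        by simp
    qed
    have "Ck_on n (E n) k (partial_deriv i (\<lambda>x. f x * g x)) \<longleftrightarrow>
        Ck_on n (E n) k (\<lambda>x. f x * partial_deriv i g x + partial_deriv i f x * g x)"
      by (intro Ck_on_cong partial_deriv_eq d)
    moreover have "Ck_on n (E n) k (\<lambda>x. f x * partial_deriv i g x + partial_deriv i f x * g x)"
      using Suc.prems i Ck_on_Suc_imp
      by (intro Ck_on_add Suc.IH) (simp_all only: Ck_on_E_Suc simp_thms, blast+)
    ultimately show ?thesis
      using d by (auto simp: real_differentiable_def)
  qed
  then show ?case
    using Suc.prems by (simp only: Ck_on_E_Suc) (auto intro!: continuous_intros)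
qed

lemma smooth_add: "smooth n f \<Longrightarrow> smooth n g \<Longrightarrow> smooth n (\<lambda>x. f x + g x)"
  by (simp add: smooth_on_def Ck_on_add)

lemma smooth_mult: "smooth n f \<Longrightarrow> smooth n g \<Longrightarrow> smooth n (\<lambda>x. f x * g x)"
  by (simp add: smooth_on_def Ck_on_mult)

lemma smooth_minus: "smooth n f \<Longrightarrow> smooth n (\<lambda>x. - f x)"
  using smooth_mult[OF smooth_const[of n "- 1"], of f] by simp

lemma smooth_diff: "smooth n f \<Longrightarrow> smooth n g \<Longrightarrow> smooth n (\<lambda>x. f x - g x)"
  using smooth_add[OF _ smooth_minus, of n f g] by simp

lemma smooth_sum: "(\<And>i. i \<in> I \<Longrightarrow> smooth n (f i)) \<Longrightarrow> smooth n (\<lambda>x. \<Sum>i\<in>I. f i x)"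
  by (induction I rule: infinite_finite_induct) (auto intro: smooth_const smooth_add)

lemma continuous_on_update:
  assumes "smooth n G" "i < n" "continuous_on S X" "continuous_on S w" "X ` S \<subseteq> E n"
  shows "continuous_on S (\<lambda>z. G ((X z)(i := w z)))"
proof (rule continuous_on_compose2[OF smooth_continuous[OF assms(1)]])
  show "continuous_on S (\<lambda>z. (X z)(i := w z))"
  proof (rule continuous_on_coordinatewise_then_product)
    fix j
    have "continuous_on S (\<lambda>z. X z j)"
      by (rule continuous_on_product_then_coordinatewise[OF assms(3)])
    then show "continuous_on S (\<lambda>z. ((X z)(i := w z)) j)"
      using assms(4) by (cases "j = i") auto
  qed
  show "(\<lambda>z. (X z)(i := w z)) ` S \<subseteq> E n"
    using assms(2,5) by (auto simp: E_upd image_subset_iff)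
qed

text \<open>
Freezing a coordinate makes the derivative in its direction vanish and commutes with the others, hence
the additional member \<open>0\<close> of the coinductive family.
\<close>

lemma smooth_subst_const:
  assumes "smooth n f" "i < n"
  shows "smooth n (\<lambda>x. f (x(i := c)))"
proof (rule smooth_coinduct[where
      P = "\<lambda>h. (\<exists>f. smooth n f \<and> h = (\<lambda>x. f (x(i := c)))) \<or> h = (\<lambda>x. 0)"])
  fix h :: "vect \<Rightarrow> real"
  assume "(\<exists>f. smooth n f \<and> h = (\<lambda>x. f (x(i := c)))) \<or> h = (\<lambda>x. 0)"
  moreover have "continuous_on (E n) (\<lambda>x. f (x(i := c)))" if "smooth n f" for f
    using continuous_on_update[OF that assms(2) continuous_on_id continuous_on_const, of "E n" c] by simp
  ultimately show "continuous_on (E n) h"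
    by auto
next
  fix h :: "vect \<Rightarrow> real" and j
  assume h: "(\<exists>f. smooth n f \<and> h = (\<lambda>x. f (x(i := c)))) \<or> h = (\<lambda>x. 0)" and j: "j < n"
  show "\<exists>g. ((\<exists>f. smooth n f \<and> g = (\<lambda>x. f (x(i := c)))) \<or> g = (\<lambda>x. 0)) \<and>
     (\<forall>x\<in>E n. ((\<lambda>t. h (x(j := t))) has_real_derivative g x) (at (x j)))"
  proof (cases "h = (\<lambda>x. 0) \<or> j = i")
    case True
    then show ?thesis
      using h by (intro exI[of _ "\<lambda>x. 0"]) auto
  next
    case False
    then obtain f where f: "smooth n f" "h = (\<lambda>x. f (x(i := c)))" and ij: "j \<noteq> i"
      using h by auto
    have "((\<lambda>t. h (x(j := t))) has_real_derivative partial_deriv j f (x(i := c))) (at (x j))"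
      if "x \<in> E n" for x
      using smooth_has_partial[OF f(1) j, of "x(i := c)"] that ij assms(2)
      by (simp add: f E_upd fun_upd_twist)
    then show ?thesis
      using smooth_partial[OF f(1) j]
      by (intro exI[of _ "\<lambda>x. partial_deriv j f (x(i := c))"]) blast
  qed
qed (use assms in auto)

section \<open>Hadamard's lemma in one coordinate\<close>

text \<open>
The factor \<open>t ^ m\<close> closes this family under partial derivatives: differentiating along
coordinate \<open>i\<close> produces a further factor \<open>t\<close> by the chain rule.
\<close>

definition segment_integral :: "nat \<Rightarrow> real \<Rightarrow> nat \<Rightarrow> (vect \<Rightarrow> real) \<Rightarrow> vect \<Rightarrow> real" where
  "segment_integral i c m G x = integral {0..1} (\<lambda>t. t ^ m * G (x(i := c + t * (x i - c))))"

lemma segment_integral_continuous: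
  assumes "smooth n G" "i < n"
  shows "continuous_on (E n) (segment_integral i c m G)"
proof -
  have "continuous_on (E n \<times> cbox 0 (1::real)) (\<lambda>z. G ((fst z)(i := c + snd z * (fst z i - c))))"
    by (intro continuous_on_update[OF assms] continuous_intros
          continuous_on_product_then_coordinatewise[OF continuous_on_fst[OF continuous_on_id]]) auto
  then have "continuous_on (E n \<times> cbox 0 (1::real))
      (\<lambda>(x, t). t ^ m * G (x(i := c + t * (x i - c))))"
    unfolding split_beta by (intro continuous_intros)
  from integral_continuous_on_param[OF this] show ?thesis
    by (simp add: segment_integral_def[abs_def])
qed

text \<open>
This is differentiation under the integral sign, applied on the compact interval.
\<close>

lemma segment_integral_has_partial:
  assumes G: "smooth n G" and i: "i < n" and j: "j < n" and x: "x \<in> E n"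
  shows "((\<lambda>y. segment_integral i c m G (x(j := y))) has_real_derivative
     segment_integral i c (if j = i then Suc m else m) (partial_deriv j G) x) (at (x j))"
proof -
  let ?m = "if j = i then Suc m else m"
  let ?s = "\<lambda>y t. (x(j := y))(i := c + t * ((x(j := y)) i - c))"
  have d: "((\<lambda>y. t ^ m * G (?s y t)) has_real_derivative t ^ ?m * partial_deriv j G (?s y t)) (at y)"
    for y t
  proof (cases "j = i")
    case True
    have "((\<lambda>u. G (x(i := u))) has_real_derivative partial_deriv i G (x(i := c + t * (y - c))))
        (at (c + t * (y - c)))"
      by (rule smooth_has_partial_at[OF G i x])
    moreover have "((\<lambda>y. c + t * (y - c)) has_real_derivative t) (at y)"
      by (auto intro!: derivative_eq_intros)
    ultimately have "((\<lambda>y. G (x(i := c + t * (y - c)))) has_real_derivative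
        partial_deriv i G (x(i := c + t * (y - c))) * t) (at y)"
      by (rule DERIV_chain2)
    from DERIV_cmult[OF this, of "t ^ m"] show ?thesis
      using True by (simp add: ac_simps)
  next
    case False
    have "x(i := c + t * (x i - c)) \<in> E n"
      using x i by (rule E_upd)
    from smooth_has_partial_at[OF G j this] show ?thesis
      using False by (intro DERIV_cmult[THEN DERIV_cong]) (auto simp: fun_upd_twist)
  qed
  have cont: "continuous_on S (\<lambda>z. H (?s (fst z) (snd z)))" if "smooth n H" for S H
  proof (rule continuous_on_update[OF that i])
    show c: "continuous_on S (\<lambda>z :: real \<times> real. x(j := fst z))"
    proof (rule continuous_on_coordinatewise_then_product)
      show "continuous_on S (\<lambda>z :: real \<times> real. (x(j := fst z)) k)" for k
        by (cases "k = j") (auto intro!: continuous_intros)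
    qed
    show "continuous_on S (\<lambda>z :: real \<times> real. c + snd z * ((x(j := fst z)) i - c))"
      by (intro continuous_intros continuous_on_product_then_coordinatewise[OF c])
    show "(\<lambda>z :: real \<times> real. x(j := fst z)) ` S \<subseteq> E n"
      using x j by (auto simp: E_upd)
  qed
  have int: "(\<lambda>t. t ^ m * G (?s y t)) integrable_on cbox 0 1" for y
  proof (rule integrable_continuous)
    have "continuous_on (cbox 0 1) (\<lambda>t. (\<lambda>z. G (?s (fst z) (snd z))) (y, t))"
      by (rule continuous_on_compose2[OF cont[OF G, of UNIV]]) (auto intro!: continuous_intros)
    then show "continuous_on (cbox 0 1) (\<lambda>t. t ^ m * G (?s y t))"
      by (intro continuous_intros) simp
  qed
  have cont': "continuous_on (UNIV \<times> cbox 0 1) (\<lambda>(y, t). t ^ ?m * partial_deriv j G (?s y t))"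
    unfolding split_beta
    by (intro continuous_on_mult cont smooth_partial[OF G j] continuous_intros)
  have "((\<lambda>y. integral (cbox 0 1) (\<lambda>t. t ^ m * G (?s y t))) has_real_derivative
      integral (cbox 0 1) (\<lambda>t. t ^ ?m * partial_deriv j G (?s (x j) t))) (at (x j) within UNIV)"
    by (rule leibniz_rule_field_derivative[OF d int cont']) simp_all
  then show ?thesis
    by (simp add: segment_integral_def)
qed

lemma smooth_segment_integral:
  assumes "smooth n G" "i < n"
  shows "smooth n (segment_integral i c m G)"
proof (rule smooth_coinduct[where P = "\<lambda>h. \<exists>m G. smooth n G \<and> h = segment_integral i c m G"])
  show "\<exists>m' G'. smooth n G' \<and> segment_integral i c m G = segment_integral i c m' G'"
    using assms by blast
next
  fix h assume "\<exists>m G. smooth n G \<and> h = segment_integral i c m G"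
  then show "continuous_on (E n) h"
    using assms(2) by (auto intro: segment_integral_continuous)
next
  fix h j assume "\<exists>m G. smooth n G \<and> h = segment_integral i c m G" and j: "j < n"
  then obtain m G where h: "smooth n G" "h = segment_integral i c m G"
    by blast
  let ?g = "segment_integral i c (if j = i then Suc m else m) (partial_deriv j G)"
  have "(\<exists>m G. smooth n G \<and> ?g = segment_integral i c m G)"
    using smooth_partial[OF h(1) j] by blast
  then show "\<exists>g. (\<exists>m G. smooth n G \<and> g = segment_integral i c m G) \<and>
     (\<forall>x\<in>E n. ((\<lambda>t. h (x(j := t))) has_real_derivative g x) (at (x j)))"
    using segment_integral_has_partial[OF h(1) assms(2) j, of _ c m] h(2)
    by (intro exI[of _ ?g]) simp
qed

text \<open>
The fundamental theorem of calculus on the segment that moves only coordinate \<open>i\<close>. Working in one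
coordinate at a time keeps every intermediate function in the family of \<open>segment_integral\<close>.
\<close>

lemma hadamard:
  assumes f: "smooth n f" and i: "i < n" and x: "x \<in> E n"
  shows "f x = f (x(i := c)) + (x i - c) * segment_integral i c 0 (partial_deriv i f) x"
proof -
  have "((\<lambda>t. f (x(i := c + t * (x i - c)))) has_real_derivative
      (x i - c) * partial_deriv i f (x(i := c + t * (x i - c)))) (at t within {0..1})" for t
  proof -
    have "((\<lambda>t. c + t * (x i - c)) has_real_derivative (x i - c)) (at t)"
      by (auto intro!: derivative_eq_intros)
    from DERIV_chain2[OF smooth_has_partial_at[OF f i x] this] show ?thesis
      by (auto simp: mult.commute intro: has_field_derivative_at_within)
  qed
  then have d: "((\<lambda>t. f (x(i := c + t * (x i - c)))) has_vector_derivative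
      (x i - c) * partial_deriv i f (x(i := c + t * (x i - c)))) (at t within {0..1})" for t
    by (simp only: has_real_derivative_iff_has_vector_derivative)
  have "((\<lambda>t. (x i - c) * partial_deriv i f (x(i := c + t * (x i - c)))) has_integral
      f (x(i := c + 1 * (x i - c))) - f (x(i := c + 0 * (x i - c)))) {0..1}"
    by (intro fundamental_theorem_of_calculus d) simp
  from integral_unique[OF this] show ?thesis
    by (simp add: segment_integral_def)
qed

lemma segment_integral_at_base:
  "x i = c \<Longrightarrow> segment_integral i c 0 G x = G x"
  by (simp add: segment_integral_def flip: fun_upd_def) (metis fun_upd_triv)

section \<open>Tangent vectors are coordinate vectors\<close>

definition Rn :: "nat \<Rightarrow> vect manifold" where
  "Rn n = \<lparr>mtop = Euclidean_space n, mdim = n, matlas = {(E n, \<lambda>x. x)}\<rparr>"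

lemma Rn_simps [simp]:
  "mtop (Rn n) = Euclidean_space n" "mdim (Rn n) = n" "matlas (Rn n) = {(E n, \<lambda>x. x)}"
  by (simp_all add: Rn_def)

lemma inv_into_ident [simp]: "x \<in> A \<Longrightarrow> inv_into A (\<lambda>x. x) x = x"
  using inv_into_f_f[of "\<lambda>x. x" A x] by simp

lemma second_countable_Euclidean_space: "second_countable (Euclidean_space n)"
proof -
  obtain B :: "vect set set" where B: "countable B" "topological_basis B"
    using ex_countable_basis by blast
  then have "second_countable (euclidean :: vect topology)"
    unfolding second_countable_def
    by (intro exI[of _ B]) (auto simp: topological_basis_open elim: topological_basisE)
  then show ?thesis
    by (simp add: Euclidean_space_def euclidean_product_topology second_countable_subtopology)
qed

lemma smooth_manifold_Rn: "smooth_manifold (Rn n)"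
proof -
  have "smooth n (\<lambda>x. inv_into (E n) (\<lambda>x. x) x i)" for i
    using smooth_cong[of n "\<lambda>x. inv_into (E n) (\<lambda>x. x) x i" "\<lambda>x. x i"] smooth_coord by simp
  then show ?thesis
    by (simp add: smooth_manifold_def second_countable_Euclidean_space metrizable_Euclidean_space
        metrizable_imp_Hausdorff_space homeomorphic_map_id[unfolded id_def])
qed

abbreviation SF :: "nat \<Rightarrow> (vect \<Rightarrow> real) set" where
  "SF n \<equiv> smooth_functions (Rn n)"

text \<open>
Smooth functions on a manifold vanish off its points, so functions given by a formula have to be
truncated before a tangent vector can be applied to them.
\<close>

definition zero_ext :: "nat \<Rightarrow> (vect \<Rightarrow> real) \<Rightarrow> vect \<Rightarrow> real" where
  "zero_ext n f = (\<lambda>p. if p \<in> E n then f p else 0)"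

definition coord :: "nat \<Rightarrow> nat \<Rightarrow> vect \<Rightarrow> real" where
  "coord n i = zero_ext n (\<lambda>p. p i)"

lemma SF_iff: "f \<in> SF n \<longleftrightarrow> (\<forall>p. p \<notin> E n \<longrightarrow> f p = 0) \<and> smooth n f"
proof -
  have "smooth n (\<lambda>x. f (inv_into (E n) (\<lambda>x. x) x)) \<longleftrightarrow> smooth n f"
    by (rule smooth_cong) simp
  then show ?thesis
    by (simp add: smooth_functions_def)
qed

lemma smooth_zero_ext: "smooth n (zero_ext n f) \<longleftrightarrow> smooth n f"
  by (rule smooth_cong) (simp add: zero_ext_def)

lemma zero_ext_SF: "smooth n f \<Longrightarrow> zero_ext n f \<in> SF n"
  by (simp add: SF_iff smooth_zero_ext) (simp add: zero_ext_def)

lemma zero_ext_apply: "p \<in> E n \<Longrightarrow> zero_ext n f p = f p"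
  by (simp add: zero_ext_def)

lemma zero_ext_SF_eq: "f \<in> SF n \<Longrightarrow> zero_ext n f = f"
  by (auto simp: SF_iff zero_ext_def fun_eq_iff)

lemma SF_smooth: "f \<in> SF n \<Longrightarrow> smooth n f"
  by (simp add: SF_iff)

lemma SF_zero: "f \<in> SF n \<Longrightarrow> p \<notin> E n \<Longrightarrow> f p = 0"
  by (simp add: SF_iff)

lemma SF_add: "f \<in> SF n \<Longrightarrow> h \<in> SF n \<Longrightarrow> f + h \<in> SF n"
  by (simp add: SF_iff plus_fun_def smooth_add)

lemma SF_mult: "f \<in> SF n \<Longrightarrow> h \<in> SF n \<Longrightarrow> f * h \<in> SF n"
  by (simp add: SF_iff times_fun_def smooth_mult)

lemma SF_scaleR: "f \<in> SF n \<Longrightarrow> c *\<^sub>R f \<in> SF n"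
  using smooth_mult[OF smooth_const[of n c], of f] by (simp add: SF_iff scaleR_fun_def)

lemma SF_diff: "f \<in> SF n \<Longrightarrow> h \<in> SF n \<Longrightarrow> f - h \<in> SF n"
  by (simp add: SF_iff fun_diff_def smooth_diff)

lemma SF_0: "0 \<in> SF n"
  by (simp add: SF_iff zero_fun_def smooth_const)

lemma SF_sum: "(\<And>i. i \<in> I \<Longrightarrow> f i \<in> SF n) \<Longrightarrow> (\<Sum>i\<in>I. f i) \<in> SF n"
  by (induction I rule: infinite_finite_induct) (auto intro: SF_0 SF_add)

lemma coord_SF: "coord n i \<in> SF n"
  unfolding coord_def by (intro zero_ext_SF smooth_coord)

lemma coord_apply: "p \<in> E n \<Longrightarrow> coord n i p = p i"
  by (simp add: coord_def zero_ext_def)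

lemma partial_deriv_add:
  assumes "f \<in> SF n" "h \<in> SF n" "i < n" "p \<in> E n"
  shows "partial_deriv i (f + h) p = partial_deriv i f p + partial_deriv i h p"
  unfolding plus_fun_def using assms
  by (intro partial_deriv_eq DERIV_add smooth_has_partial[where n = n] SF_smooth)

lemma partial_deriv_mult:
  assumes "f \<in> SF n" "h \<in> SF n" "i < n" "p \<in> E n"
  shows "partial_deriv i (f * h) p = f p * partial_deriv i h p + h p * partial_deriv i f p"
proof -
  have "((\<lambda>t. f (p(i := t)) * h (p(i := t))) has_real_derivative
      f (p(i := p i)) * partial_deriv i h p + partial_deriv i f p * h (p(i := p i))) (at (p i))"
    using assms by (intro DERIV_mult' smooth_has_partial[where n = n] SF_smooth)
  then show ?thesis
    unfolding times_fun_def by (intro partial_deriv_eq) (simp add: mult.commute)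
qed

lemma partial_deriv_scaleR:
  assumes "f \<in> SF n" "i < n" "p \<in> E n"
  shows "partial_deriv i (c *\<^sub>R f) p = c * partial_deriv i f p"
  unfolding scaleR_fun_def real_scaleR_def using assms
  by (intro partial_deriv_eq DERIV_cmult smooth_has_partial[where n = n] SF_smooth)

lemma partial_deriv_coord:
  assumes "p \<in> E n" "i < n"
  shows "partial_deriv i (coord n j) p = (if j = i then 1 else 0)"
proof (rule partial_deriv_eq)
  have "(\<lambda>t. coord n j (p(i := t))) = (\<lambda>t. if j = i then t else p j)"
    using assms by (auto simp: coord_apply E_upd)
  then show "((\<lambda>t. coord n j (p(i := t))) has_real_derivative (if j = i then 1 else 0)) (at (p i))"
    by auto
qed

abbreviation T :: "nat \<Rightarrow> vect \<Rightarrow> vect tvec set" where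
  "T n p \<equiv> tangent_space (Rn n) p"

text \<open>
The coordinate vector \<open>\<Sum> c_i \<partial>_i\<close> at \<open>p\<close> as a derivation.
\<close>

definition tvec :: "nat \<Rightarrow> vect \<Rightarrow> vect \<Rightarrow> vect tvec" where
  "tvec n p c = (\<lambda>f. if f \<in> SF n then \<Sum>i<n. c i * partial_deriv i f p else 0)"

definition components :: "nat \<Rightarrow> vect tvec \<Rightarrow> nat \<Rightarrow> real" where
  "components n v = (\<lambda>i. if i < n then v (coord n i) else 0)"

lemma tangent_add: "v \<in> T n p \<Longrightarrow> f \<in> SF n \<Longrightarrow> h \<in> SF n \<Longrightarrow> v (f + h) = v f + v h"
  and tangent_mult: "v \<in> T n p \<Longrightarrow> f \<in> SF n \<Longrightarrow> h \<in> SF n \<Longrightarrow> v (f * h) = f p * v h + h p * v f"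
  and tangent_scaleR: "v \<in> T n p \<Longrightarrow> f \<in> SF n \<Longrightarrow> v (c *\<^sub>R f) = c * v f"
  and tangent_outside: "v \<in> T n p \<Longrightarrow> f \<notin> SF n \<Longrightarrow> v f = 0"
  by (simp_all add: tangent_space_def)

lemma tangent_diff:
  assumes "v \<in> T n p" "f \<in> SF n" "h \<in> SF n"
  shows "v (f - h) = v f - v h"
  using tangent_add[OF assms(1) SF_diff[OF assms(2,3)] assms(3)] by simp

lemma tangent_0:
  assumes "v \<in> T n p"
  shows "v 0 = 0"
  using tangent_diff[OF assms SF_0 SF_0] by simp

lemma tangent_sum:
  assumes "v \<in> T n p" "\<And>i. i \<in> I \<Longrightarrow> f i \<in> SF n"
  shows "v (\<Sum>i\<in>I. f i) = (\<Sum>i\<in>I. v (f i))"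
  using assms(2)
  by (induction I rule: infinite_finite_induct)
     (auto simp: tangent_0[OF assms(1)] tangent_add[OF assms(1)] SF_sum)

text \<open>
A derivation kills \<open>1\<close> because \<open>1 * 1 = 1\<close>.
\<close>

lemma tangent_const:
  assumes v: "v \<in> T n p" and p: "p \<in> E n"
  shows "v (zero_ext n (\<lambda>_. c)) = 0"
proof -
  let ?one = "zero_ext n (\<lambda>_. 1)"
  have one: "?one \<in> SF n"
    by (intro zero_ext_SF smooth_const)
  have "?one * ?one = ?one"
    by (auto simp: zero_ext_def times_fun_def)
  then have "v ?one = 0"
    using tangent_mult[OF v one one] zero_ext_apply[OF p, of "\<lambda>_. 1"] by simp
  moreover have "zero_ext n (\<lambda>_. c) = c *\<^sub>R ?one"
    by (auto simp: zero_ext_def scaleR_fun_def)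
  ultimately show ?thesis
    using tangent_scaleR[OF v one] by simp
qed

lemma tvec_tangent:
  assumes "p \<in> E n"
  shows "tvec n p c \<in> T n p"
  using assms unfolding tangent_space_def tvec_def
  by (simp add: SF_add SF_mult SF_scaleR partial_deriv_add partial_deriv_mult partial_deriv_scaleR
      sum.distrib sum_distrib_left algebra_simps)

text \<open>
In Hadamard's decomposition of \<open>f\<close> the remainder is a product of \<open>x_i - p_i\<close>, which vanishes at \<open>p\<close>,
and a function with value \<open>\<partial>_i f\<close> at \<open>p\<close>; the Leibniz rule leaves only the latter value.
\<close>

lemma tangent_freeze_coordinate:
  assumes v: "v \<in> T n p" and p: "p \<in> E n" and f: "smooth n f" and i: "i < n"
  shows "v (zero_ext n f) = v (zero_ext n (\<lambda>x. f (x(i := p i)))) + v (coord n i) * partial_deriv i f p"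
proof -
  let ?h = "zero_ext n (segment_integral i (p i) 0 (partial_deriv i f))"
  let ?x = "coord n i - zero_ext n (\<lambda>_. p i)" and ?g = "zero_ext n (\<lambda>x. f (x(i := p i)))"
  have h: "?h \<in> SF n"
    by (intro zero_ext_SF smooth_segment_integral smooth_partial f i)
  have x: "?x \<in> SF n"
    by (intro SF_diff coord_SF zero_ext_SF smooth_const)
  have g: "?g \<in> SF n"
    by (intro zero_ext_SF smooth_subst_const f i)
  have "zero_ext n f = ?g + ?x * ?h"
  proof
    show "zero_ext n f x = (?g + ?x * ?h) x" for x
      using hadamard[OF f i, of x "p i"] by (simp add: zero_ext_def coord_def)
  qed
  then have "v (zero_ext n f) = v ?g + (?x p * v ?h + ?h p * v ?x)"
    by (simp only: tangent_add[OF v g SF_mult[OF x h]] tangent_mult[OF v x h])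
  moreover have "?x p = 0" "?h p = partial_deriv i f p"
    using p by (simp_all add: zero_ext_apply coord_apply segment_integral_at_base)
  moreover have "v ?x = v (coord n i)"
    using tangent_diff[OF v coord_SF zero_ext_SF[OF smooth_const]] tangent_const[OF v p] by simp
  ultimately show ?thesis
    by simp
qed

text \<open>
Freezing all coordinates one after the other turns \<open>f\<close> into a constant, and each step splits off
one summand.
\<close>

lemma tangent_expand:
  assumes v: "v \<in> T n p" and p: "p \<in> E n" and f: "f \<in> SF n"
  shows "v f = (\<Sum>i<n. v (coord n i) * partial_deriv i f p)"
proof -
  let ?r = "\<lambda>k x. f (\<lambda>j. if j < k then p j else x j)"
  have "smooth n (?r k) \<and> v f = v (zero_ext n (?r k)) + (\<Sum>i<k. v (coord n i) * partial_deriv i f p)"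
    if "k \<le> n" for k
    using that
  proof (induction k)
    case 0
    then show ?case
      using f by (simp add: SF_smooth zero_ext_SF_eq)
  next
    case (Suc k)
    then have k: "k < n" and s: "smooth n (?r k)"
      by simp_all
    \<comment> \<open>Coordinates are frozen in increasing order, so the derivative taken at step \<open>k\<close> still sees
      the original values of \<open>f\<close> along coordinate \<open>k\<close> through \<open>p\<close>.\<close>
    have r: "?r (Suc k) = (\<lambda>x. ?r k (x(k := p k)))"
      by (intro ext arg_cong[of _ _ f]) auto
    have "(\<lambda>t. ?r k (p(k := t))) = (\<lambda>t. f (p(k := t)))"
      by (intro ext arg_cong[of _ _ f]) auto
    then have "partial_deriv k (?r k) p = partial_deriv k f p"
      by (simp add: partial_deriv_def)
    then show ?case
      using Suc tangent_freeze_coordinate[OF v p s k] smooth_subst_const[OF s k, of "p k"]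
      unfolding r by simp
  qed
  from this[of n] have "v f = v (zero_ext n (?r n)) + (\<Sum>i<n. v (coord n i) * partial_deriv i f p)"
    by simp
  moreover have "zero_ext n (?r n) = zero_ext n (\<lambda>_. f p)"
  proof -
    have "(\<lambda>j. if j < n then p j else x j) = p" if "x \<in> E n" for x
      using that p by (auto simp: E_iff)
    then show ?thesis
      by (auto simp: zero_ext_def)
  qed
  ultimately show ?thesis
    using tangent_const[OF v p] by simp
qed

lemma components_E: "components n v \<in> E n"
  by (simp add: components_def E_iff)

lemma tvec_components:
  assumes "v \<in> T n p" "p \<in> E n"
  shows "tvec n p (components n v) = v"
  using assms by (auto simp: tvec_def components_def fun_eq_iff tangent_outside tangent_expand
      intro!: sum.cong)

lemma components_tvec:
  assumes "p \<in> E n" "c \<in> E n"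
  shows "components n (tvec n p c) = c"
  using assms by (auto simp: components_def tvec_def coord_SF partial_deriv_coord fun_eq_iff E_iff
      if_distrib[of "\<lambda>x. _ * x"] sum.delta cong: if_cong)

lemma tvec_coord: "p \<in> E n \<Longrightarrow> k < n \<Longrightarrow> tvec n p c (coord n k) = c k"
  by (simp add: tvec_def coord_SF partial_deriv_coord if_distrib[of "\<lambda>x. _ * x"] sum.delta
      cong: if_cong)

lemma tvec_linear: "linear (tvec n p)"
  by (rule linearI) (auto simp: tvec_def fun_eq_iff scaleR_fun_def algebra_simps sum.distrib
      sum_distrib_left)

lemma components_linear: "linear (components n)"
  by (rule linearI) (auto simp: components_def fun_eq_iff scaleR_fun_def)

lemma tangent_space_eq: "p \<in> E n \<Longrightarrow> T n p = tvec n p ` E n"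
  by (auto simp: tvec_tangent image_iff) (metis components_E tvec_components)

section \<open>Vector fields\<close>

abbreviation VF :: "nat \<Rightarrow> vect vfield set" where
  "VF n \<equiv> vector_fields (Rn n)"

definition coef :: "nat \<Rightarrow> vect vfield \<Rightarrow> nat \<Rightarrow> vect \<Rightarrow> real" where
  "coef n X k = (\<lambda>p. X p (coord n k))"

definition coord_field :: "nat \<Rightarrow> (vect \<Rightarrow> nat \<Rightarrow> real) \<Rightarrow> vect vfield" where
  "coord_field n F = (\<lambda>p. if p \<in> E n then tvec n p (F p) else 0)"

lemma VF_tangent: "X \<in> VF n \<Longrightarrow> p \<in> E n \<Longrightarrow> X p \<in> T n p"
  and VF_outside: "X \<in> VF n \<Longrightarrow> p \<notin> E n \<Longrightarrow> X p = 0"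
  and VF_SF: "X \<in> VF n \<Longrightarrow> f \<in> SF n \<Longrightarrow> (\<lambda>p. X p f) \<in> SF n"
  unfolding vector_fields_def Rn_simps by blast+

lemma scaleR_apply: "(c *\<^sub>R f) x = c *\<^sub>R f x"
  by (simp add: scaleR_fun_def)

lemma VF_I:
  assumes "\<And>p. p \<in> E n \<Longrightarrow> X p \<in> T n p" "\<And>p. p \<notin> E n \<Longrightarrow> X p = 0"
    and "\<And>f. f \<in> SF n \<Longrightarrow> (\<lambda>p. X p f) \<in> SF n"
  shows "X \<in> VF n"
  unfolding vector_fields_def Rn_simps
  by (intro CollectI conjI ballI allI impI; rule assms; assumption)

lemma coef_SF: "X \<in> VF n \<Longrightarrow> coef n X k \<in> SF n"
  unfolding coef_def by (rule VF_SF[OF _ coord_SF])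

lemma deriv_coef_SF: "X \<in> VF n \<Longrightarrow> Y \<in> VF n \<Longrightarrow> (\<lambda>p. X p (coef n Y k)) \<in> SF n"
  by (rule VF_SF[OF _ coef_SF])

lemma components_coef: "components n (X p) k = (if k < n then coef n X k p else 0)"
  by (simp add: components_def coef_def)

lemma smooth_components: "X \<in> VF n \<Longrightarrow> smooth n (\<lambda>p. components n (X p) k)"
  using SF_smooth[OF coef_SF] by (cases "k < n") (simp_all add: components_coef smooth_const)

lemma coord_field_VF:
  assumes "\<And>i. i < n \<Longrightarrow> smooth n (\<lambda>p. F p i)"
  shows "coord_field n F \<in> VF n"
proof -
  have "(\<lambda>p. coord_field n F p f) \<in> SF n" if f: "f \<in> SF n" for f
  proof -
    have "(\<lambda>p. coord_field n F p f) = zero_ext n (\<lambda>p. \<Sum>i<n. F p i * partial_deriv i f p)"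
      using f by (auto simp: coord_field_def tvec_def zero_ext_def)
    moreover have "smooth n (\<lambda>p. \<Sum>i<n. F p i * partial_deriv i f p)"
      using assms smooth_partial[OF SF_smooth[OF f]] by (intro smooth_sum smooth_mult) auto
    ultimately show ?thesis
      by (simp add: zero_ext_SF)
  qed
  moreover have "coord_field n F p \<in> T n p" if "p \<in> E n" for p
    using that by (simp add: coord_field_def tvec_tangent)
  moreover have "coord_field n F p = 0" if "p \<notin> E n" for p
    using that by (simp add: coord_field_def)
  ultimately show ?thesis
    by (intro VF_I)
qed

text \<open>
By the expansion of tangent vectors, a field is determined by its coefficient functions; every identity
between fields below is checked on them.
\<close>

lemma VF_eqI:
  assumes "X \<in> VF n" "Y \<in> VF n"
    and "\<And>p k. p \<in> E n \<Longrightarrow> k < n \<Longrightarrow> coef n X k p = coef n Y k p"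
  shows "X = Y"
proof
  fix p
  show "X p = Y p"
  proof (cases "p \<in> E n")
    case True
    then have "components n (X p) = components n (Y p)"
      using assms(3) by (auto simp: components_coef)
    then show ?thesis
      using tvec_components[OF VF_tangent[OF assms(1) True] True]
        tvec_components[OF VF_tangent[OF assms(2) True] True] by metis
  qed (simp add: VF_outside[OF assms(1)] VF_outside[OF assms(2)])
qed

text \<open>
Constant coefficients extend a tangent vector. This is what makes pointwise quantities, such as the
curvature tensor, determined by identities between fields.
\<close>

lemma vector_extends:
  assumes "v \<in> T n p" "p \<in> E n"
  obtains X where "X \<in> VF n" "X p = v"
proof
  show "coord_field n (\<lambda>_. components n v) \<in> VF n"
    by (intro coord_field_VF smooth_const)
  show "coord_field n (\<lambda>_. components n v) p = v"
    using assms by (simp add: coord_field_def tvec_components)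
qed

lemma T_add: "v \<in> tangent_space M p \<Longrightarrow> w \<in> tangent_space M p \<Longrightarrow> v + w \<in> tangent_space M p"
  and T_diff: "v \<in> tangent_space M p \<Longrightarrow> w \<in> tangent_space M p \<Longrightarrow> v - w \<in> tangent_space M p"
  and T_scaleR: "v \<in> tangent_space M p \<Longrightarrow> c *\<^sub>R v \<in> tangent_space M p"
  by (simp_all add: tangent_space_def scaleR_apply algebra_simps)

lemma VF_add:
  assumes "X \<in> VF n" "Y \<in> VF n"
  shows "X + Y \<in> VF n"
proof (rule VF_I)
  show "(X + Y) p \<in> T n p" if "p \<in> E n" for p
    using that assms by (simp add: VF_tangent T_add)
  show "(X + Y) p = 0" if "p \<notin> E n" for p
    using VF_outside[OF assms(1) that] VF_outside[OF assms(2) that] by simp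
  show "(\<lambda>p. (X + Y) p f) \<in> SF n" if "f \<in> SF n" for f
    using SF_add[OF VF_SF[OF assms(1) that] VF_SF[OF assms(2) that]] by (simp add: plus_fun_def)
qed

lemma VF_diff:
  assumes "X \<in> VF n" "Y \<in> VF n"
  shows "X - Y \<in> VF n"
proof (rule VF_I)
  show "(X - Y) p \<in> T n p" if "p \<in> E n" for p
    using that assms by (simp add: VF_tangent T_diff)
  show "(X - Y) p = 0" if "p \<notin> E n" for p
    using VF_outside[OF assms(1) that] VF_outside[OF assms(2) that] by simp
  show "(\<lambda>p. (X - Y) p f) \<in> SF n" if "f \<in> SF n" for f
    using SF_diff[OF VF_SF[OF assms(1) that] VF_SF[OF assms(2) that]] by (simp add: fun_diff_def)
qed

lemma VF_fmult:
  assumes "f \<in> SF n" "X \<in> VF n"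
  shows "fmult f X \<in> VF n"
proof (rule VF_I)
  show "(fmult f X) p \<in> T n p" if "p \<in> E n" for p
    using that assms by (simp add: VF_tangent T_scaleR fmult_def)
  show "(fmult f X) p = 0" if "p \<notin> E n" for p
    using VF_outside[OF assms(2) that] by (simp add: fmult_def)
  show "(\<lambda>p. (fmult f X) p h) \<in> SF n" if "h \<in> SF n" for h
    using SF_mult[OF assms(1) VF_SF[OF assms(2) that]]
    by (simp add: fmult_def times_fun_def scaleR_apply)
qed

lemma coef_add: "coef n (X + Y) k = coef n X k + coef n Y k"
  and coef_diff: "coef n (X - Y) k = coef n X k - coef n Y k"
  and coef_fmult: "coef n (fmult f X) k = f * coef n X k"
  by (auto simp: coef_def fmult_def scaleR_apply)

text \<open>
The mixed terms \<open>Y h * X f + Y f * X h\<close> in the product rule are symmetric in \<open>X\<close> and \<open>Y\<close>. They therefore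
cancel in the Lie bracket, which is again a derivation.
\<close>

lemma second_derivative_rules:
  assumes X: "X \<in> VF n" and Y: "Y \<in> VF n" and p: "p \<in> E n" and f: "f \<in> SF n"
  shows "X p (\<lambda>q. Y q (c *\<^sub>R f)) = c * X p (\<lambda>q. Y q f)" (is ?scale)
    and "h \<in> SF n \<Longrightarrow> X p (\<lambda>q. Y q (f + h)) = X p (\<lambda>q. Y q f) + X p (\<lambda>q. Y q h)"
    and "h \<in> SF n \<Longrightarrow> X p (\<lambda>q. Y q (f * h)) =
      f p * X p (\<lambda>q. Y q h) + Y p h * X p f + (h p * X p (\<lambda>q. Y q f) + Y p f * X p h)"
proof -
  note Xp = VF_tangent[OF X p]
  have Yf: "(\<lambda>q. Y q f) \<in> SF n"
    by (rule VF_SF[OF Y f])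
  have "(\<lambda>q. Y q (c *\<^sub>R f)) = c *\<^sub>R (\<lambda>q. Y q f)"
  proof
    show "Y q (c *\<^sub>R f) = (c *\<^sub>R (\<lambda>q. Y q f)) q" for q
      using f by (cases "q \<in> E n")
        (simp_all add: tangent_scaleR[OF VF_tangent[OF Y]] VF_outside[OF Y] scaleR_apply)
  qed
  then show ?scale
    using tangent_scaleR[OF Xp Yf] by simp
  assume h: "h \<in> SF n"
  have Yh: "(\<lambda>q. Y q h) \<in> SF n"
    by (rule VF_SF[OF Y h])
  have "(\<lambda>q. Y q (f + h)) = (\<lambda>q. Y q f) + (\<lambda>q. Y q h)"
  proof
    show "Y q (f + h) = ((\<lambda>q. Y q f) + (\<lambda>q. Y q h)) q" for q
      using f h by (cases "q \<in> E n")
        (simp_all add: tangent_add[OF VF_tangent[OF Y]] VF_outside[OF Y])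
  qed
  then show "X p (\<lambda>q. Y q (f + h)) = X p (\<lambda>q. Y q f) + X p (\<lambda>q. Y q h)"
    by (simp only: tangent_add[OF Xp Yf Yh])
  have "(\<lambda>q. Y q (f * h)) = f * (\<lambda>q. Y q h) + h * (\<lambda>q. Y q f)"
  proof
    show "Y q (f * h) = (f * (\<lambda>q. Y q h) + h * (\<lambda>q. Y q f)) q" for q
      using f h by (cases "q \<in> E n")
        (simp_all add: tangent_mult[OF VF_tangent[OF Y]] VF_outside[OF Y])
  qed
  then show "X p (\<lambda>q. Y q (f * h)) =
      f p * X p (\<lambda>q. Y q h) + Y p h * X p f + (h p * X p (\<lambda>q. Y q f) + Y p f * X p h)"
    by (simp only: tangent_add[OF Xp SF_mult[OF f Yh] SF_mult[OF h Yf]]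
        tangent_mult[OF Xp f Yh] tangent_mult[OF Xp h Yf])
qed

lemma VF_lie_bracket:
  assumes X: "X \<in> VF n" and Y: "Y \<in> VF n"
  shows "lie_bracket (Rn n) X Y \<in> VF n"
proof -
  have "lie_bracket (Rn n) X Y p \<in> T n p" if p: "p \<in> E n" for p
    unfolding tangent_space_def lie_bracket_def
    using second_derivative_rules[OF X Y p] second_derivative_rules[OF Y X p]
    by (simp add: SF_add SF_mult SF_scaleR right_diff_distrib)
  moreover have "lie_bracket (Rn n) X Y p = 0" if "p \<notin> E n" for p
    using VF_outside[OF X that] VF_outside[OF Y that] by (simp add: lie_bracket_def fun_eq_iff)
  moreover have "(\<lambda>p. lie_bracket (Rn n) X Y p f) \<in> SF n" if "f \<in> SF n" for f
    using SF_diff[OF VF_SF[OF X VF_SF[OF Y that]] VF_SF[OF Y VF_SF[OF X that]]] that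
    by (simp add: lie_bracket_def fun_diff_def)
  ultimately show ?thesis
    by (intro VF_I)
qed

lemma coef_lie_bracket: "coef n (lie_bracket (Rn n) X Y) k p = X p (coef n Y k) - Y p (coef n X k)"
  by (simp add: coef_def lie_bracket_def coord_SF)

section \<open>Connections given by a bilinear term\<close>

definition smooth_bilinear ::
    "nat \<Rightarrow> (vect \<Rightarrow> vect \<Rightarrow> vect \<Rightarrow> vect) \<Rightarrow> bool" where
  "smooth_bilinear n A \<longleftrightarrow> (\<forall>p. bilinear (A p)) \<and>
     (\<forall>F H k. (\<forall>i. smooth n (\<lambda>p. F p i)) \<and> (\<forall>i. smooth n (\<lambda>p. H p i)) \<longrightarrow>
        smooth n (\<lambda>p. A p (F p) (H p) k))"

lemma smooth_bilinear_smooth: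
  assumes "smooth_bilinear n A" "\<And>i. smooth n (\<lambda>p. F p i)" "\<And>i. smooth n (\<lambda>p. H p i)"
  shows "smooth n (\<lambda>p. A p (F p) (H p) k)"
  using assms unfolding smooth_bilinear_def by blast

text \<open>
The flat derivative of the coefficients plus a bilinear correction \<open>A\<close>, whose entries are the
Christoffel symbols.
\<close>

definition connection ::
    "nat \<Rightarrow> (vect \<Rightarrow> vect \<Rightarrow> vect \<Rightarrow> vect) \<Rightarrow>
     vect connection" where
  "connection n A X Y = (if X \<in> VF n \<and> Y \<in> VF n
     then coord_field n (\<lambda>p k. X p (coef n Y k) + A p (components n (X p)) (components n (Y p)) k) else 0)"

lemma connection_VF:
  assumes A: "smooth_bilinear n A" and X: "X \<in> VF n" and Y: "Y \<in> VF n"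
  shows "connection n A X Y \<in> VF n"
proof -
  have "smooth n (\<lambda>p. A p (components n (X p)) (components n (Y p)) k)" for k
    by (intro smooth_bilinear_smooth[OF A] smooth_components X Y)
  then show ?thesis
    using X Y SF_smooth[OF deriv_coef_SF[OF X Y]]
    by (auto simp: connection_def intro!: coord_field_VF smooth_add)
qed

lemma coef_connection:
  assumes "X \<in> VF n" "Y \<in> VF n" "p \<in> E n" "k < n"
  shows "coef n (connection n A X Y) k p = X p (coef n Y k) + A p (components n (X p)) (components n (Y p)) k"
  unfolding coef_def[of n "connection n A X Y"] using assms
  by (simp add: connection_def coord_field_def tvec_coord)

lemma components_add: "components n (v + w) = components n v + components n w"
  and components_scaleR: "components n (c *\<^sub>R v) = c *\<^sub>R components n v"
  using components_linear by (auto simp: linear_add linear_scale)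

lemma connection_affine:
  assumes A: "smooth_bilinear n A"
  shows "affine_connection (Rn n) (connection n A)"
  unfolding affine_connection_def
proof (intro conjI allI impI ballI)
  have bil: "bilinear (A p)" for p
    using A by (simp add: smooth_bilinear_def)
  note Asimps = bilinear_ladd[OF bil] bilinear_radd[OF bil] bilinear_lmul[OF bil]
    bilinear_rmul[OF bil] components_add components_scaleR
  show "connection n A X Y = 0" if "X \<notin> VF n \<or> Y \<notin> VF n" for X Y
    using that by (auto simp: connection_def)
  fix X Y assume X: "X \<in> VF n" and Y: "Y \<in> VF n"
  show "connection n A X Y \<in> VF n"
    using A X Y by (rule connection_VF)
  fix Z assume Z: "Z \<in> VF n"
  show "connection n A (X + Z) Y = connection n A X Y + connection n A Z Y"
    by (rule VF_eqI[where n = n])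
      (auto simp: X Y Z VF_add connection_VF[OF A] coef_connection coef_add Asimps)
  show "connection n A X (Y + Z) = connection n A X Y + connection n A X Z"
    by (rule VF_eqI[where n = n])
      (auto simp: X Y Z VF_add connection_VF[OF A] coef_connection coef_add Asimps
        tangent_add[OF VF_tangent[OF X]] coef_SF)
next
  have bil: "bilinear (A p)" for p
    using A by (simp add: smooth_bilinear_def)
  note Asimps = bilinear_ladd[OF bil] bilinear_radd[OF bil] bilinear_lmul[OF bil]
    bilinear_rmul[OF bil] components_add components_scaleR
  fix X Y f assume X: "X \<in> VF n" and Y: "Y \<in> VF n" and f: "f \<in> SF n"
  have Xf: "(\<lambda>p. X p f) \<in> SF n"
    by (rule VF_SF[OF X f])
  have *: "components n (fmult f Z p) = f p *\<^sub>R components n (Z p)" for Z p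
    by (simp add: fmult_def components_scaleR)
  show "connection n A (fmult f X) Y = fmult f (connection n A X Y)"
  proof (rule VF_eqI[where n = n])
    show "coef n (connection n A (fmult f X) Y) k p = coef n (fmult f (connection n A X Y)) k p"
      if "p \<in> E n" "k < n" for p k
      using that by (simp add: X Y f VF_fmult coef_connection coef_fmult * Asimps)
        (simp add: fmult_def scaleR_apply algebra_simps)
  qed (simp_all add: X Y f VF_fmult connection_VF[OF A])
  show "connection n A X (fmult f Y) = fmult (\<lambda>p. X p f) Y + fmult f (connection n A X Y)"
  proof (rule VF_eqI[where n = n])
    show "coef n (connection n A X (fmult f Y)) k p =
        coef n (fmult (\<lambda>p. X p f) Y + fmult f (connection n A X Y)) k p" if "p \<in> E n" "k < n" for p k
      using that by (simp add: X Y f VF_fmult coef_connection coef_fmult coef_add * Asimps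
          tangent_mult[OF VF_tangent[OF X]] coef_SF)
        (simp add: scaleR_apply algebra_simps)
  qed (simp_all add: X Y f Xf VF_fmult VF_add connection_VF[OF A])
qed

lemma connection_torsion_free:
  assumes A: "smooth_bilinear n A" and sym: "\<And>p x y. A p x y = A p y x"
    and X: "X \<in> VF n" and Y: "Y \<in> VF n"
  shows "connection n A X Y - connection n A Y X = lie_bracket (Rn n) X Y"
proof (rule VF_eqI[where n = n])
  show "coef n (connection n A X Y - connection n A Y X) k p = coef n (lie_bracket (Rn n) X Y) k p"
    if "p \<in> E n" "k < n" for p k
    using that sym[of p "components n (X p)" "components n (Y p)"]
    by (simp add: X Y coef_diff coef_connection coef_lie_bracket)
qed (simp_all add: X Y VF_diff VF_lie_bracket connection_VF[OF A])

lemma metric_tensor: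
  assumes g: "pseudo_riemannian_manifold M g" and p: "p \<in> points M"
    and x: "x \<in> tangent_space M p" and y: "y \<in> tangent_space M p"
  shows metric_sym: "g p x y = g p y x"
    and metric_add: "z \<in> tangent_space M p \<Longrightarrow> g p (x + y) z = g p x z + g p y z"
    and metric_scale: "g p (c *\<^sub>R x) y = c * g p x y"
proof -
  have *: "\<forall>p\<in>points M. \<forall>x\<in>tangent_space M p. \<forall>y\<in>tangent_space M p.
      g p x y = g p y x \<and>
      (\<forall>z\<in>tangent_space M p. g p (x + y) z = g p x z + g p y z) \<and>
      (\<forall>c. g p (c *\<^sub>R x) y = c * g p x y)"
    using g unfolding pseudo_riemannian_manifold_def by (elim conjE)
  note * = bspec[OF bspec[OF bspec[OF * p] x] y]
  show "g p x y = g p y x"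
    using * by (rule conjunct1)
  show "g p (x + y) z = g p x z + g p y z" if "z \<in> tangent_space M p"
    by (rule bspec[OF conjunct1[OF conjunct2[OF *]] that])
  show "g p (c *\<^sub>R x) y = c * g p x y"
    by (rule spec[OF conjunct2[OF conjunct2[OF *]]])
qed

lemma metric_diff:
  assumes g: "pseudo_riemannian_manifold M g" and p: "p \<in> points M"
    and x: "x \<in> tangent_space M p" and y: "y \<in> tangent_space M p" and z: "z \<in> tangent_space M p"
  shows "g p (x - y) z = g p x z - g p y z"
  using metric_add[OF g p T_diff[OF x y] y z] by simp

lemma metric_nondegenerate:
  assumes g: "pseudo_riemannian_manifold M g" and p: "p \<in> points M"
    and x: "x \<in> tangent_space M p" and 0: "\<And>y. y \<in> tangent_space M p \<Longrightarrow> g p x y = 0"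
  shows "x = 0"
proof -
  have "\<forall>p\<in>points M. \<forall>x\<in>tangent_space M p. (\<forall>y\<in>tangent_space M p. g p x y = 0) \<longrightarrow> x = 0"
    using g unfolding pseudo_riemannian_manifold_def by (elim conjE)
  then show ?thesis
    using p x 0 by blast
qed

text \<open>
The difference \<open>S\<close> of two Levi-Civita connections satisfies \<open>S X Y = S Y X\<close> and
\<open>g (S X Y) Z = - g (S X Z) Y\<close>. Alternating the two symmetries six times returns the original term with
the opposite sign, so \<open>S = 0\<close>. The hypothesis on fields makes
\<open>Z p\<close> range over all tangent vectors, so that nondegeneracy applies.
\<close>

lemma levi_civita_unique:
  assumes extends: "\<And>p v. p \<in> points M \<Longrightarrow> v \<in> tangent_space M p \<Longrightarrow> \<exists>Z\<in>vector_fields M. Z p = v"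
    and g: "pseudo_riemannian_manifold M g"
    and D: "is_levi_civita M g D" and D': "is_levi_civita M g D'"
  shows "D = D'"
proof (rule ext, rule ext, rule ext)
  fix X Y p
  have aff: "affine_connection M D" "affine_connection M D'"
    using D D' by (simp_all add: is_levi_civita_def)
  have VF: "D X Y \<in> vector_fields M" "D' X Y \<in> vector_fields M"
    if "X \<in> vector_fields M" "Y \<in> vector_fields M" for X Y
    using aff that unfolding affine_connection_def by blast+
  have other: "D X Y = 0 \<and> D' X Y = 0" if "\<not> (X \<in> vector_fields M \<and> Y \<in> vector_fields M)"
    using aff that unfolding affine_connection_def by blast
  have outside: "W p = 0" if "W \<in> vector_fields M" "p \<notin> points M" for W
    using that unfolding vector_fields_def by blast
  show "D X Y p = D' X Y p"
  proof (cases "X \<in> vector_fields M \<and> Y \<in> vector_fields M \<and> p \<in> points M")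
    case False
    then show ?thesis
      using other VF outside by (cases "X \<in> vector_fields M \<and> Y \<in> vector_fields M") auto
  next
    case True
    then have p: "p \<in> points M"
      by blast
    let ?S = "\<lambda>X Y. D X Y p - D' X Y p"
    have tan: "W p \<in> tangent_space M p" if "W \<in> vector_fields M" for W
      using that p unfolding vector_fields_def by blast
    note minus = metric_diff[OF g p] and gsym = metric_sym[OF g p]
    have symm: "?S X Y = ?S Y X" if "X \<in> vector_fields M" "Y \<in> vector_fields M" for X Y
    proof -
      have "D X Y - D Y X = D' X Y - D' Y X"
        using D D' that unfolding is_levi_civita_def by metis
      then have "(D X Y - D Y X) p = (D' X Y - D' Y X) p"
        by simp
      then show ?thesis
        by (simp add: algebra_simps)
    qed
    have skew: "g p (?S X Y) (Z p) = - g p (?S X Z) (Y p)"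
      if "X \<in> vector_fields M" "Y \<in> vector_fields M" "Z \<in> vector_fields M" for X Y Z
    proof -
      have "g p (D X Y p) (Z p) + g p (Y p) (D X Z p) = g p (D' X Y p) (Z p) + g p (Y p) (D' X Z p)"
        using D D' that p unfolding is_levi_civita_def by metis
      then show ?thesis
        using that by (simp add: minus VF tan gsym[of "Y p"])
    qed
    have "g p (?S X Y) (Z p) = 0" if "Z \<in> vector_fields M" for Z
    proof -
      have XY: "X \<in> vector_fields M" "Y \<in> vector_fields M"
        using True by auto
      note Z = that
      have "g p (?S X Y) (Z p) = - g p (?S X Z) (Y p)"
        using skew XY Z by blast
      also have "\<dots> = - g p (?S Z X) (Y p)"
        using symm[of X Z] XY Z by simp
      also have "\<dots> = g p (?S Z Y) (X p)"
        using skew[of Z X Y] XY Z by simp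
      also have "\<dots> = g p (?S Y Z) (X p)"
        using symm[of Y Z] XY Z by simp
      also have "\<dots> = - g p (?S Y X) (Z p)"
        using skew[of Y Z X] XY Z by simp
      also have "\<dots> = - g p (?S X Y) (Z p)"
        using symm[of X Y] XY by simp
      finally show ?thesis
        by simp
    qed
    then have "g p (?S X Y) z = 0" if "z \<in> tangent_space M p" for z
      using extends[OF p that] by metis
    moreover have "?S X Y \<in> tangent_space M p"
      using True by (intro T_diff tan VF) auto
    ultimately have "?S X Y = 0"
      using metric_nondegenerate[OF g p] by blast
    then show ?thesis
      by simp
  qed
qed

section \<open>Curvature in coordinates\<close>

lemma coef_ge:
  assumes "X \<in> VF n" "n \<le> k"
  shows "coef n X k = 0"
proof
  have "coord n k = 0"
    using assms(2) by (auto simp: coord_def zero_ext_def E_iff)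
  then show "coef n X k p = 0 p" for p
    using tangent_0[OF VF_tangent[OF assms(1)]] VF_outside[OF assms(1)]
    by (cases "p \<in> E n") (simp_all add: coef_def)
qed

lemma components_VF: "X \<in> VF n \<Longrightarrow> components n (X p) = (\<lambda>k. coef n X k p)"
  by (auto simp: components_coef coef_ge)

text \<open>
The Leibniz rule for \<open>v (A Y Z)\<close> with a remainder \<open>A'\<close>, which is the derivative of the coefficients of
\<open>A\<close> in the direction \<open>v\<close>. Specifying \<open>A'\<close> by this identity avoids treating \<open>A\<close> as a matrix of functions.
\<close>

definition product_rule :: "nat \<Rightarrow> (vect \<Rightarrow> vect \<Rightarrow> vect \<Rightarrow> vect) \<Rightarrow>
    (vect \<Rightarrow> vect \<Rightarrow> vect \<Rightarrow> vect \<Rightarrow> vect) \<Rightarrow> bool" where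
  "product_rule n A A' \<longleftrightarrow> (\<forall>p\<in>E n. \<forall>v\<in>T n p. \<forall>Y\<in>VF n. \<forall>Z\<in>VF n. \<forall>k<n.
     v (zero_ext n (\<lambda>q. A q (components n (Y q)) (components n (Z q)) k)) =
       A p (\<lambda>i. v (coef n Y i)) (components n (Z p)) k + A p (components n (Y p)) (\<lambda>i. v (coef n Z i)) k +
       A' p (components n v) (components n (Y p)) (components n (Z p)) k)"

text \<open>
The classical formula \<open>\<partial>_x \<Gamma> - \<partial>_y \<Gamma> + [\<Gamma>_x, \<Gamma>_y]\<close> applied to \<open>z\<close>.
\<close>

definition coord_curvature :: "(vect \<Rightarrow> vect \<Rightarrow> vect \<Rightarrow> vect) \<Rightarrow>
    (vect \<Rightarrow> vect \<Rightarrow> vect \<Rightarrow> vect \<Rightarrow> vect) \<Rightarrow> vect \<Rightarrow> vect \<Rightarrow> vect \<Rightarrow> vect \<Rightarrow> vect" where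
  "coord_curvature A A' p x y z =
     A' p x y z - A' p y x z + A p x (A p y z) - A p y (A p x z)"

lemma components_connection:
  assumes "X \<in> VF n" "Y \<in> VF n" "p \<in> E n"
    and "\<And>p x y. A p x y \<in> E n"
  shows "components n (connection n A X Y p) = (\<lambda>k. X p (coef n Y k)) + A p (components n (X p)) (components n (Y p))"
proof
  fix k
  show "components n (connection n A X Y p) k = ((\<lambda>k. X p (coef n Y k)) + A p (components n (X p)) (components n (Y p))) k"
  proof (cases "k < n")
    case True
    then show ?thesis
      using assms by (simp add: components_coef coef_connection)
  next
    case False
    then show ?thesis
      using assms(4)[of p "components n (X p)" "components n (Y p)"] assms(1-3)
      by (simp add: components_def coef_ge E_iff tangent_0[OF VF_tangent])
  qed
qed

lemma connection_second_derivative: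
  assumes A: "smooth_bilinear n A" and A_E: "\<And>p x y. A p x y \<in> E n"
    and A': "product_rule n A A'"
    and X: "X \<in> VF n" and Y: "Y \<in> VF n" and Z: "Z \<in> VF n" and p: "p \<in> E n" and k: "k < n"
  shows "coef n (connection n A X (connection n A Y Z)) k p = X p (\<lambda>q. Y q (coef n Z k)) +
    A p (\<lambda>i. X p (coef n Y i)) (components n (Z p)) k + A p (components n (Y p)) (\<lambda>i. X p (coef n Z i)) k +
    A' p (components n (X p)) (components n (Y p)) (components n (Z p)) k +
    A p (components n (X p)) (\<lambda>i. Y p (coef n Z i)) k +
    A p (components n (X p)) (A p (components n (Y p)) (components n (Z p))) k"
proof -
  have bil: "bilinear (A p)"
    using A by (simp add: smooth_bilinear_def)
  let ?YZ = "\<lambda>q. Y q (coef n Z k)"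
  let ?A = "zero_ext n (\<lambda>q. A q (components n (Y q)) (components n (Z q)) k)"
  have "smooth n (\<lambda>q. A q (components n (Y q)) (components n (Z q)) k)"
    by (intro smooth_bilinear_smooth[OF A] smooth_components Y Z)
  then have SF: "?YZ \<in> SF n" "?A \<in> SF n"
    using deriv_coef_SF[OF Y Z] by (simp_all add: zero_ext_SF)
  have "coef n (connection n A Y Z) k = ?YZ + ?A"
  proof
    show "coef n (connection n A Y Z) k q = (?YZ + ?A) q" for q
      using coef_connection[OF Y Z _ k, of q A] VF_outside[OF Y] VF_outside[OF connection_VF[OF A Y Z]]
      by (cases "q \<in> E n") (simp_all add: zero_ext_def coef_def)
  qed
  then have "X p (coef n (connection n A Y Z) k) = X p ?YZ + X p ?A"
    using SF by (simp add: tangent_add[OF VF_tangent[OF X p]])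
  also have "X p ?A = A p (\<lambda>i. X p (coef n Y i)) (components n (Z p)) k +
      A p (components n (Y p)) (\<lambda>i. X p (coef n Z i)) k +
      A' p (components n (X p)) (components n (Y p)) (components n (Z p)) k"
    using A' VF_tangent[OF X p] Y Z p k unfolding product_rule_def by blast
  finally show ?thesis
    using X Y Z p k
    by (simp add: coef_connection connection_VF[OF A] components_connection A_E bilinear_radd[OF bil])
qed

text \<open>
In \<open>[D_X, D_Y] Z\<close> all terms that differentiate the coefficients of \<open>X\<close>, \<open>Y\<close> or \<open>Z\<close> are either symmetric in
\<open>X\<close> and \<open>Y\<close> or matched by \<open>D_[X, Y] Z\<close>. What remains involves only the values at \<open>p\<close>; this is the
tensoriality that the definition of the curvature tensor relies on.
\<close>

lemma curvature_operator_connection: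
  assumes A: "smooth_bilinear n A" and A_E: "\<And>p x y. A p x y \<in> E n"
    and A': "product_rule n A A'"
    and lc: "levi_civita (Rn n) g = connection n A"
    and X: "X \<in> VF n" and Y: "Y \<in> VF n" and Z: "Z \<in> VF n" and p: "p \<in> E n"
  shows "curvature_operator (Rn n) g X Y Z p =
    tvec n p (coord_curvature A A' p (components n (X p)) (components n (Y p)) (components n (Z p)))"
proof -
  have bil: "bilinear (A p)"
    using A by (simp add: smooth_bilinear_def)
  let ?R = "curvature_operator (Rn n) g X Y Z"
  have R: "?R = connection n A X (connection n A Y Z) - connection n A Y (connection n A X Z) -
      connection n A (lie_bracket (Rn n) X Y) Z"
    by (simp add: curvature_operator_def Let_def lc)
  have R_VF: "?R \<in> VF n"
    unfolding R by (intro VF_diff connection_VF[OF A] VF_lie_bracket X Y Z)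
  have br: "components n (lie_bracket (Rn n) X Y p) =
      (\<lambda>i. X p (coef n Y i)) - (\<lambda>i. Y p (coef n X i))"
    using X Y by (auto simp: components_VF VF_lie_bracket coef_lie_bracket)
  have brZ: "lie_bracket (Rn n) X Y p (coef n Z k) =
      X p (\<lambda>q. Y q (coef n Z k)) - Y p (\<lambda>q. X q (coef n Z k))" for k
    using Z by (simp add: lie_bracket_def coef_SF)
  have "components n (?R p) k =
      components n (tvec n p (coord_curvature A A' p (components n (X p)) (components n (Y p)) (components n (Z p)))) k"
    for k
  proof (cases "k < n")
    case True
    have "coef n ?R k p =
        coord_curvature A A' p (components n (X p)) (components n (Y p)) (components n (Z p)) k"
      unfolding R coef_diff
      using True X Y Z p
      by (simp add: connection_second_derivative[OF A A_E A'] coef_connection[OF VF_lie_bracket] br brZ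
          bilinear_lsub[OF bil] coord_curvature_def)
    moreover have "components n (tvec n p c) k = c k" for c
      using True p by (simp add: components_def tvec_coord)
    ultimately show ?thesis
      using True by (simp add: components_coef)
  qed (simp add: components_def)
  then have "components n (?R p) =
      components n (tvec n p (coord_curvature A A' p (components n (X p)) (components n (Y p)) (components n (Z p))))"
    by blast
  then show ?thesis
    using tvec_components[OF VF_tangent[OF R_VF p] p] tvec_components[OF tvec_tangent[OF p] p] by metis
qed

lemma levi_civita_eq_connection:
  assumes "pseudo_riemannian_manifold (Rn n) g" "is_levi_civita (Rn n) g D"
  shows "levi_civita (Rn n) g = D"
  unfolding levi_civita_def
proof (rule the_equality)
  show "D' = D" if "is_levi_civita (Rn n) g D'" for D'
    by (rule levi_civita_unique[OF _ assms(1) that assms(2)]) (auto elim: vector_extends)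
qed (rule assms)

text \<open>
Both definite descriptions, of the curvature value and of the Jacobi operator, are met by the
coordinate expression: the first because every tangent vector extends to a field, the second by
nondegeneracy.
\<close>

lemma jacobi_coord:
  assumes A: "smooth_bilinear n A" and A_E: "\<And>p x y. A p x y \<in> E n"
    and A': "product_rule n A A'"
    and g: "pseudo_riemannian_manifold (Rn n) g"
    and lc: "is_levi_civita (Rn n) g (connection n A)"
    and p: "p \<in> E n" and x: "x \<in> T n p" and y: "y \<in> T n p"
  shows "jacobi (Rn n) g p x y =
    tvec n p (coord_curvature A A' p (components n y) (components n x) (components n x))"
proof -
  let ?J = "tvec n p (coord_curvature A A' p (components n y) (components n x) (components n x))"
  have cur: "curvature (Rn n) g p y x x z = g p ?J z" if z: "z \<in> T n p" for z
    unfolding curvature_def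
  proof (rule the_equality)
    note op = curvature_operator_connection[OF A A_E A' levi_civita_eq_connection[OF g lc] _ _ _ p]
    show "\<forall>X\<in>VF n. \<forall>Y\<in>VF n. \<forall>Z\<in>VF n. \<forall>W\<in>VF n. X p = y \<and> Y p = x \<and> Z p = x \<and> W p = z \<longrightarrow>
       g p ?J z = g p (curvature_operator (Rn n) g X Y Z p) (W p)"
      by (simp add: op)
    fix r
    assume r: "\<forall>X\<in>VF n. \<forall>Y\<in>VF n. \<forall>Z\<in>VF n. \<forall>W\<in>VF n. X p = y \<and> Y p = x \<and> Z p = x \<and> W p = z \<longrightarrow>
       r = g p (curvature_operator (Rn n) g X Y Z p) (W p)"
    obtain X Y W where "X \<in> VF n" "X p = x" "Y \<in> VF n" "Y p = y" "W \<in> VF n" "W p = z"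
      using x y z p by (metis vector_extends)
    then show "r = g p ?J z"
      using r op[of Y X X] by metis
  qed
  show ?thesis
    unfolding jacobi_def
  proof (rule the_equality)
    show "?J \<in> T n p \<and> (\<forall>z\<in>T n p. g p ?J z = curvature (Rn n) g p y x x z)"
      using p by (simp add: cur tvec_tangent)
    fix v
    assume v: "v \<in> T n p \<and> (\<forall>z\<in>T n p. g p v z = curvature (Rn n) g p y x x z)"
    have J: "?J \<in> T n p"
      by (rule tvec_tangent[OF p])
    have "g p (v - ?J) z = 0" if "z \<in> T n p" for z
      using metric_diff[OF g _ _ J that, of v] v that p cur by simp
    then have "v - ?J = 0"
      using metric_nondegenerate[OF g _ T_diff[OF _ J], of v] v p by simp
    then show "v = ?J"
      by simp
  qed
qed

section \<open>The metric and its Levi-Civita connection\<close>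

definition dot :: "nat \<Rightarrow> vect \<Rightarrow> vect \<Rightarrow> real" where
  "dot s a b = (\<Sum>i<s. a i * b i)"

text \<open>
A coordinate vector \<open>x\<close> of length \<open>3 * s\<close> is read as three blocks \<open>x\<close>, \<open>shift s x\<close>, \<open>shift (2 * s) x\<close>. The
\<open>u\<close> block needs no selector since \<open>dot s\<close> reads only the first \<open>s\<close> entries.
\<close>

definition shift :: "nat \<Rightarrow> (nat \<Rightarrow> 'a) \<Rightarrow> nat \<Rightarrow> 'a" where
  "shift k a = (\<lambda>i. a (k + i))"

definition blocks :: "nat \<Rightarrow> vect \<Rightarrow> vect \<Rightarrow> vect \<Rightarrow> vect" where
  "blocks s a b c = (\<lambda>k. if k < s then a k else if k < 2 * s then b (k - s)
     else if k < 3 * s then c (k - 2 * s) else 0)"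

lemma dot_commute: "dot s a b = dot s b a"
  by (simp add: dot_def mult.commute)

lemma dot_linear:
  "dot s (\<lambda>i. f i + h i) c = dot s f c + dot s h c"
  "dot s (\<lambda>i. f i - h i) c = dot s f c - dot s h c"
  "dot s (\<lambda>i. r * f i) c = r * dot s f c"
  "dot s (\<lambda>i. - f i) c = - dot s f c"
  "dot s (\<lambda>i. 0) c = 0"
  "dot s c (\<lambda>i. f i + h i) = dot s c f + dot s c h"
  "dot s c (\<lambda>i. f i - h i) = dot s c f - dot s c h"
  "dot s c (\<lambda>i. r * f i) = r * dot s c f"
  "dot s c (\<lambda>i. - f i) = - dot s c f"
  "dot s c (\<lambda>i. 0) = 0"
  by (simp_all add: dot_def algebra_simps sum.distrib sum_subtractf sum_distrib_left sum_negf)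

lemma dot_plus: "dot s (f + h) c = dot s f c + dot s h c"
  and dot_plus_right: "dot s c (f + h) = dot s c f + dot s c h"
  and dot_scaleR: "dot s (r *\<^sub>R f) c = r * dot s f c"
  and dot_scaleR_right: "dot s c (r *\<^sub>R f) = r * dot s c f"
  by (simp_all add: dot_def algebra_simps sum.distrib sum_distrib_left scaleR_apply)

lemma shift_apply: "shift k a i = a (k + i)"
  by (simp add: shift_def)

lemma shift_plus: "shift k (f + h) = shift k f + shift k h"
  and shift_scaleR: "shift k (r *\<^sub>R f) = r *\<^sub>R shift k f"
  by (simp_all add: shift_def fun_eq_iff scaleR_apply)

lemma dot_unit: "i < s \<Longrightarrow> dot s a (\<lambda>j. if j = i then 1 else 0) = a i"
  by (simp add: dot_def if_distrib[of "\<lambda>x. _ * x"] sum.delta cong: if_cong)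

lemma blocks_apply:
  "i < s \<Longrightarrow> blocks s a b c i = a i"
  "i < s \<Longrightarrow> blocks s a b c (s + i) = b i"
  "i < s \<Longrightarrow> blocks s a b c (2 * s + i) = c i"
  by (simp_all add: blocks_def)

lemma dot_blocks:
  "dot s (blocks s a b c) d = dot s a d"
  "dot s (shift s (blocks s a b c)) d = dot s b d"
  "dot s (shift (2 * s) (blocks s a b c)) d = dot s c d"
  "dot s d (blocks s a b c) = dot s d a"
  "dot s d (shift s (blocks s a b c)) = dot s d b"
  "dot s d (shift (2 * s) (blocks s a b c)) = dot s d c"
  by (auto simp: dot_def blocks_apply shift_def intro!: sum.cong)

lemma blocks_E: "blocks s a b c \<in> E (3 * s)"
  by (simp add: blocks_def E_iff)

lemma block_cases:
  fixes k s :: nat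
  assumes "k < 3 * s"
  obtains i where "i < s" "k = i" | i where "i < s" "k = s + i" | i where "i < s" "k = 2 * s + i"
proof -
  consider "k < s" | "s \<le> k" "k < 2 * s" | "2 * s \<le> k"
    by linarith
  then show ?thesis
  proof cases
    case 1
    then show ?thesis using that(1) by blast
  next
    case 2
    then show ?thesis using that(2)[of "k - s"] by simp
  next
    case 3
    then show ?thesis using that(3)[of "k - 2 * s"] assms by simp
  qed
qed

lemma block_eqI:
  assumes "X \<in> E (3 * s)" "Y \<in> E (3 * s)"
    and "\<And>i. i < s \<Longrightarrow> X i = Y i" "\<And>i. i < s \<Longrightarrow> X (s + i) = Y (s + i)"
      "\<And>i. i < s \<Longrightarrow> X (2 * s + i) = Y (2 * s + i)"
  shows "X = Y"
proof
  show "X k = Y k" for k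
  proof (cases "k < 3 * s")
    case True
    then show ?thesis
      by (rule block_cases) (use assms(3-) in auto)
  qed (use assms(1,2) in \<open>auto simp: E_iff\<close>)
qed

lemma smooth_dot:
  assumes "\<And>i. smooth n (\<lambda>p. F p i)" "\<And>i. smooth n (\<lambda>p. H p i)"
  shows "smooth n (\<lambda>p. dot s (F p) (H p))"
  unfolding dot_def by (intro smooth_sum smooth_mult assms)

text \<open>
The product \<open>dot\<close> of function-valued vectors, as an element of the algebra on which derivations act.
\<close>

definition fun_dot :: "nat \<Rightarrow> (nat \<Rightarrow> vect \<Rightarrow> real) \<Rightarrow> (nat \<Rightarrow> vect \<Rightarrow> real) \<Rightarrow> vect \<Rightarrow> real" where
  "fun_dot s F H = (\<Sum>i<s. F i * H i)"

lemma fun_dot_apply: "fun_dot s F H p = dot s (\<lambda>i. F i p) (\<lambda>i. H i p)"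
proof -
  have "(\<Sum>i<m. F i * H i) p = (\<Sum>i<m. F i p * H i p)" for m
    by (induction m) auto
  then show ?thesis
    by (simp add: fun_dot_def dot_def)
qed

lemma fun_dot_SF: "(\<And>i. F i \<in> SF n) \<Longrightarrow> (\<And>i. H i \<in> SF n) \<Longrightarrow> fun_dot s F H \<in> SF n"
  unfolding fun_dot_def by (intro SF_sum SF_mult)

lemma tangent_fun_dot:
  assumes v: "v \<in> T n p" and F: "\<And>i. F i \<in> SF n" and H: "\<And>i. H i \<in> SF n"
  shows "v (fun_dot s F H) = dot s (\<lambda>i. v (F i)) (\<lambda>i. H i p) + dot s (\<lambda>i. F i p) (\<lambda>i. v (H i))"
  unfolding fun_dot_def
  by (simp add: tangent_sum[OF v] tangent_mult[OF v] SF_mult F H dot_def algebra_simps sum.distrib)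

text \<open>
The form \<open>2 du dv - dt^2 - 2 (u . t) du^2\<close> at \<open>p = (u, t, v)\<close>.
\<close>

definition metric_form :: "nat \<Rightarrow> vect \<Rightarrow> vect \<Rightarrow> vect \<Rightarrow> real" where
  "metric_form s p x y = dot s x (shift (2 * s) y) + dot s (shift (2 * s) x) y - dot s (shift s x) (shift s y) -
     2 * (dot s p (shift s p) * dot s x y)"

definition metric :: "nat \<Rightarrow> vect metric_tensor" where
  "metric s p v w = metric_form s p (components (3 * s) v) (components (3 * s) w)"

text \<open>
The derivative of \<open>u . t\<close> in the direction \<open>x\<close>.
\<close>

definition d_ut :: "nat \<Rightarrow> vect \<Rightarrow> vect \<Rightarrow> real" where
  "d_ut s p x = dot s x (shift s p) + dot s (shift s x) p"

text \<open>
Only the coefficient \<open>h = - 2 (u . t)\<close> of \<open>du^2\<close> varies, so \<open>2 g(A x y, z)\<close> is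
\<open>dh(x) (y . z) + dh(y) (x . z) - dh(z) (x . y)\<close>, with products of \<open>u\<close> parts. Raising the index with this metric
moves the \<open>du\<close> components of that form to the \<open>v\<close> block and its \<open>dt\<close> components, with opposite
sign, to the \<open>t\<close> block; there is no \<open>dv\<close> component, whence the \<open>u\<close> block is \<open>0\<close>.
\<close>

definition christoffel :: "nat \<Rightarrow> vect \<Rightarrow> vect \<Rightarrow> vect \<Rightarrow> vect" where
  "christoffel s p x y = blocks s (\<lambda>i. 0) (\<lambda>i. - (dot s x y * p i))
     (\<lambda>i. dot s x y * p (s + i) - d_ut s p x * y i - d_ut s p y * x i)"

definition christoffel_deriv :: "nat \<Rightarrow> vect \<Rightarrow> vect \<Rightarrow> vect \<Rightarrow> vect \<Rightarrow> vect" where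
  "christoffel_deriv s p x y z = blocks s (\<lambda>i. 0) (\<lambda>i. - (dot s y z * x i))
     (\<lambda>i. dot s y z * x (s + i) - d_ut s x y * z i - d_ut s x z * y i)"

text \<open>
The value \<open>R(y, x) x\<close> at \<open>p\<close>. The coefficients in \<open>p\<close> enter only through \<open>|u|^2\<close>, in the \<open>v\<close> block of the
image of the \<open>u\<close> block.
\<close>

definition jacobi_form :: "nat \<Rightarrow> vect \<Rightarrow> vect \<Rightarrow> vect \<Rightarrow> vect" where
  "jacobi_form s p x y = blocks s (\<lambda>i. 0) (\<lambda>i. dot s x y * x i - dot s x x * y i)
     (\<lambda>i. dot s x x * y (s + i) - (dot s x (shift s y) + dot s (shift s x) y) * x i
        + 2 * dot s x (shift s x) * y i - dot s x y * x (s + i)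
        + dot s p p * (dot s x x * y i - dot s x y * x i))"

lemma christoffel_E: "christoffel s p x y \<in> E (3 * s)"
  by (simp add: christoffel_def blocks_E)

lemma christoffel_sym: "christoffel s p x y = christoffel s p y x"
  by (simp add: christoffel_def dot_commute[of s x y] diff_diff_eq add.commute)

lemma smooth_blocks:
  assumes "\<And>i. smooth n (\<lambda>p. a p i)" "\<And>i. smooth n (\<lambda>p. b p i)" "\<And>i. smooth n (\<lambda>p. c p i)"
  shows "smooth n (\<lambda>p. blocks s (a p) (b p) (c p) k)"
  unfolding blocks_def
  by (cases "k < s"; cases "k < 2 * s"; cases "k < 3 * s") (simp_all add: assms smooth_const)

lemma christoffel_smooth_bilinear: "smooth_bilinear n (christoffel s)"
  unfolding smooth_bilinear_def
proof (intro conjI allI impI)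
  show "bilinear (christoffel s p)" for p
    unfolding bilinear_def
    by (intro conjI allI linearI ext)
       (auto simp: christoffel_def d_ut_def blocks_def dot_plus dot_plus_right dot_scaleR dot_scaleR_right
         shift_plus shift_scaleR scaleR_apply algebra_simps)
  fix F H :: "vect \<Rightarrow> vect" and k
  assume "(\<forall>i. smooth n (\<lambda>p. F p i)) \<and> (\<forall>i. smooth n (\<lambda>p. H p i))"
  then have F: "smooth n (\<lambda>p. F p i)" and H: "smooth n (\<lambda>p. H p i)" for i :: nat
    by auto
  show "smooth n (\<lambda>p. christoffel s p (F p) (H p) k)"
    unfolding christoffel_def d_ut_def
    by (intro smooth_blocks smooth_const smooth_minus smooth_diff smooth_mult smooth_add smooth_dot
        F H smooth_coord) (simp_all add: shift_def F H smooth_coord)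
qed

lemma tangent_minus: "v \<in> T n p \<Longrightarrow> f \<in> SF n \<Longrightarrow> v (- f) = - v f"
  using tangent_diff[OF _ SF_0] tangent_0 by fastforce

text \<open>
Each block entry of \<open>christoffel\<close> is written as an element of the algebra of smooth functions; the
derivation rules then expand it, and the terms that differentiate the coordinate functions of \<open>p\<close>
make up \<open>christoffel_deriv\<close>.
\<close>

lemma christoffel_product_rule: "product_rule (3 * s) (christoffel s) (christoffel_deriv s)"
  unfolding product_rule_def
proof (intro ballI allI impI)
  let ?n = "3 * s"
  fix p v Y Z k
  assume p: "p \<in> E ?n" and v: "v \<in> T ?n p" and Y: "Y \<in> VF ?n" and Z: "Z \<in> VF ?n" and k: "k < ?n"
  note tangent = tangent_add[OF v] tangent_diff[OF v] tangent_mult[OF v] tangent_fun_dot[OF v]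
    tangent_minus[OF v]
  note SF = fun_dot_SF SF_add SF_diff SF_mult coef_SF[OF Y] coef_SF[OF Z] coord_SF
  let ?y = "coef ?n Y" and ?z = "coef ?n Z" and ?u = "coord ?n"
  let ?yt = "\<lambda>i. coef ?n Y (s + i)" and ?zt = "\<lambda>i. coef ?n Z (s + i)" and ?t = "\<lambda>i. coord ?n (s + i)"
  have v_eq: "components ?n v i = v (?u i)" if "i < ?n" for i
    using that by (simp add: components_def)
  have vu: "dot s a (\<lambda>i. v (?u i)) = dot s a (components ?n v)"
    and vt: "dot s a (\<lambda>i. v (?u (s + i))) = dot s a (shift s (components ?n v))" for a
    by (auto simp: dot_def v_eq shift_def)
  show "v (zero_ext ?n (\<lambda>q. christoffel s q (components ?n (Y q)) (components ?n (Z q)) k)) =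
      christoffel s p (\<lambda>i. v (?y i)) (components ?n (Z p)) k + christoffel s p (components ?n (Y p)) (\<lambda>i. v (?z i)) k +
      christoffel_deriv s p (components ?n v) (components ?n (Y p)) (components ?n (Z p)) k"
    using k
  proof (cases rule: block_cases)
    case (1 i)
    then have "zero_ext ?n (\<lambda>q. christoffel s q (components ?n (Y q)) (components ?n (Z q)) k) = 0"
      by (auto simp: christoffel_def blocks_apply zero_ext_def)
    then show ?thesis
      using 1 by (simp add: tangent_0[OF v] christoffel_def christoffel_deriv_def blocks_apply)
  next
    case (2 i)
    then have "zero_ext ?n (\<lambda>q. christoffel s q (components ?n (Y q)) (components ?n (Z q)) k) = - (fun_dot s ?y ?z * ?u i)"
      by (auto simp: christoffel_def blocks_apply zero_ext_def coord_def fun_dot_apply scaleR_apply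
          components_VF[OF Y] components_VF[OF Z])
    then show ?thesis
      using 2 p
      by (simp add: tangent SF christoffel_def christoffel_deriv_def blocks_apply fun_dot_apply coord_apply v_eq
          components_VF[OF Y] components_VF[OF Z]) (simp add: algebra_simps)
  next
    case (3 i)
    have "zero_ext ?n (\<lambda>q. christoffel s q (components ?n (Y q)) (components ?n (Z q)) k) =
        fun_dot s ?y ?z * ?t i - (fun_dot s ?y ?t + fun_dot s ?yt ?u) * ?z i - (fun_dot s ?z ?t + fun_dot s ?zt ?u) * ?y i"
      using SF_zero[OF coef_SF[OF Y]] SF_zero[OF coef_SF[OF Z]] 3
      by (auto simp: christoffel_def blocks_apply zero_ext_def coord_def fun_dot_apply shift_def d_ut_def
          components_VF[OF Y] components_VF[OF Z])
    then show ?thesis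
      using 3 p
      by (simp add: tangent SF christoffel_def christoffel_deriv_def blocks_apply fun_dot_apply coord_apply v_eq d_ut_def vu vt
          components_VF[OF Y] components_VF[OF Z])
        (simp add: shift_def algebra_simps)
  qed
qed

text \<open>
The image of \<open>christoffel\<close> has no \<open>u\<close> part, so in the terms quadratic in it only its \<open>t\<close> part, a multiple of
\<open>u\<close>, survives; pairing this with \<open>u\<close> produces the factor \<open>|u|^2\<close>.
\<close>

lemma coord_curvature_eq: "coord_curvature (christoffel s) (christoffel_deriv s) p y x x = jacobi_form s p x y"
proof (rule block_eqI)
  show "coord_curvature (christoffel s) (christoffel_deriv s) p y x x \<in> E (3 * s)"
    by (simp add: coord_curvature_def christoffel_def christoffel_deriv_def E_iff blocks_def)
  show "jacobi_form s p x y \<in> E (3 * s)"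
    by (simp add: jacobi_form_def blocks_E)
qed (simp_all add: coord_curvature_def christoffel_def christoffel_deriv_def jacobi_form_def blocks_apply d_ut_def dot_blocks dot_linear
      shift_apply, simp_all add: algebra_simps dot_commute)

lemma metric_form_sym: "metric_form s p x y = metric_form s p y x"
  by (simp add: metric_form_def dot_commute)

lemma metric_form_add: "metric_form s p (x + y) z = metric_form s p x z + metric_form s p y z"
  by (simp add: metric_form_def shift_plus dot_plus algebra_simps)

lemma metric_form_scaleR: "metric_form s p (c *\<^sub>R x) z = c * metric_form s p x z"
  by (simp add: metric_form_def shift_scaleR dot_scaleR algebra_simps)

lemma metric_form_blocks: "metric_form s p x (blocks s a b c) = dot s x c + dot s (shift (2 * s) x) a - dot s (shift s x) b -
    2 * (dot s p (shift s p) * dot s x a)"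
  by (simp add: metric_form_def dot_blocks)

text \<open>
Testing with \<open>v\<close>, \<open>t\<close> and \<open>u\<close> basis vectors, in this order, reads off the \<open>u\<close>, \<open>t\<close> and \<open>v\<close> entries;
the perturbation \<open>- 2 (u . t)\<close> multiplies a \<open>u\<close> entry already known to vanish.
\<close>

lemma metric_form_nondegenerate:
  assumes x: "x \<in> E (3 * s)" and 0: "\<And>y. y \<in> E (3 * s) \<Longrightarrow> metric_form s p x y = 0"
  shows "x = 0"
proof (rule block_eqI[of _ s])
  let ?e = "\<lambda>i j :: nat. if j = i then 1 else 0 :: real"
  show a: "x i = 0 i" if "i < s" for i
    using 0[OF blocks_E[of s "\<lambda>_. 0" "\<lambda>_. 0" "?e i"]] that
    by (simp add: metric_form_blocks dot_linear dot_unit)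
  show "x (s + i) = 0 (s + i)" if "i < s" for i
    using 0[OF blocks_E[of s "\<lambda>_. 0" "?e i" "\<lambda>_. 0"]] that
    by (simp add: metric_form_blocks dot_linear dot_unit shift_apply)
  show "x (2 * s + i) = 0 (2 * s + i)" if "i < s" for i
    using 0[OF blocks_E[of s "?e i" "\<lambda>_. 0" "\<lambda>_. 0"]] a[OF that] that
    by (simp add: metric_form_blocks dot_linear dot_unit shift_apply)
qed (use x in \<open>simp_all add: E_iff\<close>)

lemma metric_fun_metric:
  assumes Y: "Y \<in> VF (3 * s)" and Z: "Z \<in> VF (3 * s)"
  shows "metric_fun (Rn (3 * s)) (metric s) Y Z =
    fun_dot s (coef (3 * s) Y) (shift (2 * s) (coef (3 * s) Z)) + fun_dot s (shift (2 * s) (coef (3 * s) Y)) (coef (3 * s) Z)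
    - fun_dot s (shift s (coef (3 * s) Y)) (shift s (coef (3 * s) Z))
    - 2 *\<^sub>R (fun_dot s (coord (3 * s)) (shift s (coord (3 * s))) * fun_dot s (coef (3 * s) Y) (coef (3 * s) Z))"
proof
  fix p
  show "metric_fun (Rn (3 * s)) (metric s) Y Z p = (fun_dot s (coef (3 * s) Y) (shift (2 * s) (coef (3 * s) Z))
      + fun_dot s (shift (2 * s) (coef (3 * s) Y)) (coef (3 * s) Z)
      - fun_dot s (shift s (coef (3 * s) Y)) (shift s (coef (3 * s) Z))
      - 2 *\<^sub>R (fun_dot s (coord (3 * s)) (shift s (coord (3 * s))) * fun_dot s (coef (3 * s) Y) (coef (3 * s) Z))) p"
  proof (cases "p \<in> E (3 * s)")
    case True
    then show ?thesis
      by (simp add: metric_fun_def metric_def metric_form_def fun_dot_apply components_VF[OF Y] components_VF[OF Z]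
          scaleR_apply coord_apply shift_def)
  next
    case False
    then show ?thesis
      using SF_zero[OF coef_SF[OF Y]]
      by (simp add: metric_fun_def fun_dot_apply scaleR_apply shift_def dot_linear)
  qed
qed

lemma shift_SF: "(\<And>i. F i \<in> SF n) \<Longrightarrow> shift k F i \<in> SF n"
  by (simp add: shift_def)

lemma metric_pseudo_riemannian: "pseudo_riemannian_manifold (Rn (3 * s)) (metric s)"
  unfolding pseudo_riemannian_manifold_def
proof (intro conjI ballI allI impI)
  show "smooth_manifold (Rn (3 * s))"
    by (rule smooth_manifold_Rn)
  show "metric s p x y = metric s p y x" for p x y
    by (simp add: metric_def metric_form_sym[of s p "components (3 * s) x"])
  show "metric s p (x + y) z = metric s p x z + metric s p y z" for p x y z
    by (simp add: metric_def components_add metric_form_add)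
  show "metric s p (c *\<^sub>R x) y = c * metric s p x y" for p c x y
    by (simp add: metric_def components_scaleR metric_form_scaleR)
  show "metric_fun (Rn (3 * s)) (metric s) X Y \<in> SF (3 * s)"
    if "X \<in> VF (3 * s)" "Y \<in> VF (3 * s)" for X Y
    unfolding metric_fun_metric[OF that]
    by (intro SF_diff SF_add SF_scaleR SF_mult fun_dot_SF shift_SF coef_SF that coord_SF)
  fix p x
  assume p: "p \<in> points (Rn (3 * s))" and x: "x \<in> T (3 * s) p"
    and 0: "\<forall>y\<in>T (3 * s) p. metric s p x y = 0"
  have p: "p \<in> E (3 * s)"
    using p by simp
  have "metric_form s p (components (3 * s) x) y = 0" if "y \<in> E (3 * s)" for y
    using 0 tvec_tangent[OF p, of y] components_tvec[OF p that] by (auto simp: metric_def)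
  then have "components (3 * s) x = 0"
    using metric_form_nondegenerate[OF components_E] by blast
  then show "x = 0"
    using tvec_components[OF x p] linear_0[OF tvec_linear] by metis
qed

text \<open>
Torsion vanishes because the bilinear term is symmetric. Compatibility with the metric reduces, after
cancelling the flat derivatives, to \<open>dh(x) (y . z) = g(A x y, z) + g(y, A x z)\<close> for the coefficient \<open>h\<close> of \<open>du^2\<close>.
\<close>

lemma christoffel_levi_civita: "is_levi_civita (Rn (3 * s)) (metric s) (connection (3 * s) (christoffel s))"
  unfolding is_levi_civita_def
proof (intro conjI ballI)
  let ?n = "3 * s"
  show "affine_connection (Rn ?n) (connection ?n (christoffel s))"
    by (rule connection_affine[OF christoffel_smooth_bilinear])
  show "connection ?n (christoffel s) X Y - connection ?n (christoffel s) Y X = lie_bracket (Rn ?n) X Y"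
    if "X \<in> VF ?n" "Y \<in> VF ?n" for X Y
    by (rule connection_torsion_free[OF christoffel_smooth_bilinear christoffel_sym that])
  fix X Y Z p
  assume X: "X \<in> VF ?n" and Y: "Y \<in> VF ?n" and Z: "Z \<in> VF ?n" and "p \<in> points (Rn ?n)"
  then have p: "p \<in> E ?n"
    by simp
  note v = VF_tangent[OF X p]
  note tangent = tangent_add[OF v] tangent_diff[OF v] tangent_mult[OF v] tangent_fun_dot[OF v]
    tangent_scaleR[OF v]
  note SF = fun_dot_SF SF_add SF_diff SF_mult SF_scaleR shift_SF coef_SF[OF Y] coef_SF[OF Z] coord_SF
  show "X p (metric_fun (Rn ?n) (metric s) Y Z) =
      metric s p (connection ?n (christoffel s) X Y p) (Z p) + metric s p (Y p) (connection ?n (christoffel s) X Z p)"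
    unfolding metric_fun_metric[OF Y Z] metric_def
      components_connection[OF X Y p christoffel_E] components_connection[OF X Z p christoffel_E]
    using p
    by (simp add: tangent SF metric_form_def christoffel_def d_ut_def shift_plus dot_plus dot_plus_right dot_blocks dot_linear
        fun_dot_apply scaleR_apply coord_apply components_VF[OF X] components_VF[OF Y] components_VF[OF Z])
      (simp add: shift_def coef_def coord_apply dot_commute algebra_simps)
qed

lemma jacobi_metric:
  assumes "p \<in> E (3 * s)" "x \<in> T (3 * s) p" "y \<in> T (3 * s) p"
  shows "jacobi (Rn (3 * s)) (metric s) p x y =
    tvec (3 * s) p (jacobi_form s p (components (3 * s) x) (components (3 * s) y))"
  using jacobi_coord[OF christoffel_smooth_bilinear christoffel_E christoffel_product_rule metric_pseudo_riemannian
      christoffel_levi_civita assms]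
  by (simp add: coord_curvature_eq)

abbreviation evec :: "nat \<Rightarrow> vect" where
  "evec i \<equiv> (\<lambda>j. if j = i then 1 else 0)"

section \<open>Signature\<close>

lemma E_subspace: "Real_Vector_Spaces.subspace (E d)"
  by (auto simp: real_vector.subspace_def E_iff scaleR_apply)

lemma E_sum_units:
  assumes "x \<in> E d"
  shows "x = (\<Sum>i<d. x i *\<^sub>R evec i)"
proof
  fix k
  have "(\<Sum>i<m. x i *\<^sub>R evec i) k = (if k < m then x k else 0)" for m
    by (induction m) (auto simp: scaleR_apply less_Suc_eq)
  then show "x k = (\<Sum>i<d. x i *\<^sub>R evec i) k"
    using assms by (simp add: E_iff)
qed

lemma E_span: "E d = span (evec ` {..<d})"
proof (rule span_unique[symmetric])
  show "evec ` {..<d} \<subseteq> E d"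
    by (auto simp: E_iff)
  fix V :: "vect set"
  assume V: "evec ` {..<d} \<subseteq> V" "Real_Vector_Spaces.subspace V"
  have "(\<Sum>i<d. x i *\<^sub>R evec i) \<in> V" for x
    using V by (intro subspace_sum subspace_scale) auto
  note in_V = this
  show "E d \<subseteq> V"
  proof
    fix x assume x: "x \<in> E d"
    show "x \<in> V"
      using in_V[of x] unfolding E_sum_units[OF x, symmetric] .
  qed
qed (rule E_subspace)

lemma units_independent: "independent (evec ` {..<d :: nat})"
  and units_inj: "inj_on evec {..<d :: nat}"
proof -
  let ?e = evec
  show inj: "inj_on ?e {..<d}"
    by (rule inj_onI) (metis zero_neq_one)
  show "independent (?e ` {..<d})"
  proof (rule independent_if_scalars_zero)
    fix f x
    assume 0: "(\<Sum>x\<in>?e ` {..<d}. f x *\<^sub>R x) = 0" and "x \<in> ?e ` {..<d}"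
    then obtain i where i: "i < d" "x = ?e i"
      by auto
    let ?c = "\<lambda>i. if i < d then f (?e i) else 0"
    have "(\<Sum>x\<in>?e ` {..<d}. f x *\<^sub>R x) = (\<Sum>i<d. ?c i *\<^sub>R ?e i)"
      by (simp add: sum.reindex[OF inj])
    also have "\<dots> = ?c"
      by (rule E_sum_units[symmetric]) (simp add: E_iff)
    finally have "?c i = 0"
      using 0 by (metis zero_fun_apply)
    then show "f x = 0"
      using i by simp
  qed simp
qed

text \<open>
The space \<open>L ` E d\<close> attains the dimension \<open>d\<close>. Conversely, a subspace on which \<open>Q\<close> holds off \<open>0\<close> meets the
kernel of \<open>N\<close> only in \<open>0\<close>, so \<open>N\<close> embeds it into \<open>E d\<close>. In place of two complementary definite subspaces it
suffices to know a parametrisation of one and a projection along the other.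
\<close>

lemma max_subspace_dimI:
  fixes L :: "vect \<Rightarrow> 'v :: real_vector" and N :: "'v \<Rightarrow> vect"
  assumes L: "linear L" "\<And>z. z \<in> E d \<Longrightarrow> L z \<in> V" "\<And>z. z \<in> E d \<Longrightarrow> z \<noteq> 0 \<Longrightarrow> Q (L z)"
    and Q0: "\<not> Q 0"
    and N: "linear N" "\<And>v. v \<in> V \<Longrightarrow> N v \<in> E d" "\<And>v. v \<in> V \<Longrightarrow> N v = 0 \<Longrightarrow> \<not> Q v"
  shows "max_subspace_dim V (\<lambda>W. \<forall>v\<in>W. v \<noteq> 0 \<longrightarrow> Q v) d"
  unfolding max_subspace_dim_def
proof (intro conjI allI impI exI[of _ "L ` E d"])
  show "Real_Vector_Spaces.subspace (L ` E d)"
    by (rule linear_subspace_image[OF L(1) E_subspace])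
  show "L ` E d \<subseteq> V"
    using L(2) by auto
  show "\<forall>v\<in>L ` E d. v \<noteq> 0 \<longrightarrow> Q v"
    using L(3) linear_0[OF L(1)] by auto
  have "inj_on L (E d)"
  proof (rule inj_onI)
    fix x y assume "x \<in> E d" "y \<in> E d" "L x = L y"
    then show "x = y"
      using L(3)[of "x - y"] Q0 linear_diff[OF L(1)] subspace_diff[OF E_subspace] by force
  qed
  then have inj: "inj_on L (span (evec ` {..<d}))"
    by (simp only: E_span)
  have "dim (L ` E d) = card (L ` evec ` {..<d})"
    unfolding E_span linear_span_image[OF L(1), symmetric] dim_span
    by (rule dim_eq_card_independent[OF
          linear_independent_injective_image[OF L(1) units_independent inj]])
  also have "\<dots> = d"
    by (simp add: card_image[OF inj_on_subset[OF inj span_superset]] card_image[OF units_inj])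
  finally show "dim (L ` E d) = d" .
next
  fix W assume W: "Real_Vector_Spaces.subspace W \<and> W \<subseteq> V \<and> (\<forall>v\<in>W. v \<noteq> 0 \<longrightarrow> Q v)"
  obtain B where B: "B \<subseteq> W" "independent B" "W \<subseteq> span B" "card B = dim W"
    by (rule basis_exists)
  then have span: "span B = W"
    using W by (metis span_subspace)
  have "inj_on N W"
  proof (rule inj_onI)
    fix x y assume xy: "x \<in> W" "y \<in> W" "N x = N y"
    then have "x - y \<in> W" "N (x - y) = 0"
      using W by (simp_all add: subspace_diff linear_diff[OF N(1)])
    then show "x = y"
      using W N(3)[of "x - y"] by (metis right_minus_eq subsetD)
  qed
  then have ind: "independent (N ` B)"
    using linear_independent_injective_image[OF N(1) B(2)] span by simp
  have "N ` B \<subseteq> span (evec ` {..<d})"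
    using B(1) W N(2) unfolding E_span[symmetric] by auto
  from independent_span_bound[OF _ ind this]
  have "card (N ` B) \<le> card (evec ` {..<d})"
    by simp
  then show "dim W \<le> d"
    using B(4) card_image[OF inj_on_subset[OF \<open>inj_on N W\<close> B(1)]] card_image[OF units_inj[of d]]
    by simp
qed

lemma dot_ge_0: "0 \<le> dot s x x"
  by (simp add: dot_def sum_nonneg)

lemma dot_pos: "i < s \<Longrightarrow> x i \<noteq> 0 \<Longrightarrow> 0 < dot s x x"
  unfolding dot_def by (rule sum_pos2[of _ i]) (auto simp: zero_less_mult_iff less_le)

lemma linear_blocks:
  assumes "linear a" "linear b" "linear c"
  shows "linear (\<lambda>x. blocks s (a x) (b x) (c x))"
  by (rule linearI) (auto simp: blocks_def fun_eq_iff scaleR_apply linear_add[OF assms(1)]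
      linear_add[OF assms(2)] linear_add[OF assms(3)] linear_scale[OF assms(1)]
      linear_scale[OF assms(2)] linear_scale[OF assms(3)])

lemma dot_cong: "(\<And>i. i < s \<Longrightarrow> x i = x' i) \<Longrightarrow> (\<And>i. i < s \<Longrightarrow> y i = y' i) \<Longrightarrow> dot s x y = dot s x' y'"
  by (auto simp: dot_def intro!: sum.cong)

text \<open>
With \<open>f = - 2 (u . t)\<close>, the lines \<open>c = - (f + 1) / 2 * a\<close> and \<open>c = (1 - f) / 2 * a\<close> in the \<open>(a, c)\<close> planes give
\<open>f |a|^2 + 2 a . c\<close> the values \<open>- |a|^2\<close> and \<open>|a|^2\<close>. The first family together with the \<open>t\<close> block is maximal
negative, the second is maximal positive, and each map \<open>?N\<close> vanishes exactly on the other family.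
\<close>

lemma metric_signature: "has_signature (Rn (3 * s)) (metric s) (2 * s, s)"
  unfolding has_signature_def split_def fst_conv snd_conv
proof (intro ballI conjI)
  let ?n = "3 * s"
  fix p assume "p \<in> points (Rn ?n)"
  then have p: "p \<in> E ?n"
    by simp
  define f where "f = - 2 * dot s p (shift s p)"
  define cn cp where "cn = - (f + 1) / 2" and "cp = (1 - f) / 2"
  have G: "metric_form s p x x = f * dot s x x + 2 * dot s x (shift (2 * s) x) - dot s (shift s x) (shift s x)" for x
    by (simp add: metric_form_def f_def dot_commute[of s "shift (2 * s) x"])
  have met: "metric s p (tvec ?n p x) (tvec ?n p x) = metric_form s p x x" if "x \<in> E ?n" for x
    using that p by (simp add: metric_def components_tvec)
  show "max_subspace_dim (T ?n p) (\<lambda>V. \<forall>v\<in>V. v \<noteq> 0 \<longrightarrow> metric s p v v < 0) (2 * s)"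
  proof (rule max_subspace_dimI)
    let ?l = "\<lambda>z. blocks s z (shift s z) (\<lambda>i. cn * z i)"
    let ?N = "\<lambda>x. blocks s (\<lambda>i. (1 - f) * x i - 2 * x (2 * s + i)) (shift s x) (\<lambda>i. 0)"
    have "linear ?l"
      by (intro linear_blocks linearI) (auto simp: shift_def scaleR_apply fun_eq_iff field_simps)
    then show "linear (\<lambda>z. tvec ?n p (?l z))"
      using linear_compose[OF _ tvec_linear] by (simp add: o_def)
    show "tvec ?n p (?l z) \<in> T ?n p" for z
      by (rule tvec_tangent[OF p])
    show "metric s p (tvec ?n p (?l z)) (tvec ?n p (?l z)) < 0" if z: "z \<in> E (2 * s)" "z \<noteq> 0" for z
    proof -
      have "metric s p (tvec ?n p (?l z)) (tvec ?n p (?l z)) = - dot s z z - dot s (shift s z) (shift s z)"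
        by (simp add: met blocks_E G dot_blocks dot_linear) (simp add: cn_def cp_def field_simps)
      moreover have "0 < dot s z z \<or> 0 < dot s (shift s z) (shift s z)"
      proof -
        obtain k where k: "z k \<noteq> 0" "k < 2 * s"
          using z by (auto simp: E_iff fun_eq_iff) (metis not_le)
        then show ?thesis
          using dot_pos[of k s z] dot_pos[of "k - s" s "shift s z"]
          by (cases "k < s") (auto simp: shift_def)
      qed
      ultimately show ?thesis
        using dot_ge_0[of s z] dot_ge_0[of s "shift s z"] by linarith
    qed
    show "\<not> metric s p 0 0 < 0"
      by (simp add: metric_def linear_0[OF components_linear] metric_form_def dot_def shift_def)
    have "linear ?N"
      by (intro linear_blocks linearI)
        (auto simp: shift_def scaleR_apply fun_eq_iff algebra_simps)
    then show "linear (\<lambda>v. ?N (components ?n v))"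
      using linear_compose[OF components_linear] by (simp add: o_def)
    show "?N (components ?n v) \<in> E (2 * s)" for v
      by (auto simp: E_iff blocks_def)
    show "\<not> metric s p v v < 0" if "?N (components ?n v) = 0" for v
    proof -
      let ?x = "components ?n v"
      have x: "?x (2 * s + i) = cp * ?x i" "?x (s + i) = 0" if i: "i < s" for i
        using fun_cong[OF \<open>?N ?x = 0\<close>, of i] fun_cong[OF \<open>?N ?x = 0\<close>, of "s + i"] i
        by (simp_all add: blocks_apply shift_def) (simp add: cp_def field_simps)
      have "dot s ?x (shift (2 * s) ?x) = dot s ?x (\<lambda>i. cp * ?x i)"
        by (rule dot_cong) (simp_all add: shift_def x)
      moreover have "dot s (shift s ?x) (shift s ?x) = dot s (\<lambda>i. 0) (\<lambda>i. 0)"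
        by (rule dot_cong) (simp_all add: shift_def x)
      ultimately have "metric s p v v = dot s ?x ?x"
        by (simp add: metric_def G dot_linear) (simp add: cn_def cp_def field_simps)
      then show ?thesis
        using dot_ge_0[of s ?x] by simp
    qed
  qed
  show "max_subspace_dim (T ?n p) (\<lambda>V. \<forall>v\<in>V. v \<noteq> 0 \<longrightarrow> metric s p v v > 0) s"
  proof (rule max_subspace_dimI)
    let ?l = "\<lambda>z. blocks s z (\<lambda>i. 0) (\<lambda>i. cp * z i)"
    let ?N = "\<lambda>x. blocks s (\<lambda>i. (1 + f) * x i + 2 * x (2 * s + i)) (\<lambda>i. 0) (\<lambda>i. 0)"
    have "linear ?l"
      by (intro linear_blocks linearI) (auto simp: scaleR_apply fun_eq_iff field_simps)
    then show "linear (\<lambda>z. tvec ?n p (?l z))"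
      using linear_compose[OF _ tvec_linear] by (simp add: o_def)
    show "tvec ?n p (?l z) \<in> T ?n p" for z
      by (rule tvec_tangent[OF p])
    show "metric s p (tvec ?n p (?l z)) (tvec ?n p (?l z)) > 0" if z: "z \<in> E s" "z \<noteq> 0" for z
    proof -
      have "metric s p (tvec ?n p (?l z)) (tvec ?n p (?l z)) = dot s z z"
        by (simp add: met blocks_E G dot_blocks dot_linear) (simp add: cn_def cp_def field_simps)
      moreover obtain k where "z k \<noteq> 0" "k < s"
        using z by (auto simp: E_iff fun_eq_iff) (metis not_le)
      ultimately show ?thesis
        using dot_pos by metis
    qed
    show "\<not> metric s p 0 0 > 0"
      by (simp add: metric_def linear_0[OF components_linear] metric_form_def dot_def shift_def)
    have "linear ?N"
      by (intro linear_blocks linearI) (auto simp: scaleR_apply fun_eq_iff algebra_simps)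
    then show "linear (\<lambda>v. ?N (components ?n v))"
      using linear_compose[OF components_linear] by (simp add: o_def)
    show "?N (components ?n v) \<in> E s" for v
      by (auto simp: E_iff blocks_def)
    show "\<not> metric s p v v > 0" if "?N (components ?n v) = 0" for v
    proof -
      let ?x = "components ?n v"
      have x: "?x (2 * s + i) = cn * ?x i" if i: "i < s" for i
        using fun_cong[OF \<open>?N ?x = 0\<close>, of i] i by (simp add: blocks_apply cn_def field_simps)
      have "dot s ?x (shift (2 * s) ?x) = dot s ?x (\<lambda>i. cn * ?x i)"
        by (rule dot_cong) (simp_all add: shift_def x)
      then have "metric s p v v = - dot s ?x ?x - dot s (shift s ?x) (shift s ?x)"
        by (simp add: metric_def G dot_linear) (simp add: cn_def cp_def field_simps)
      then show ?thesis
        using dot_ge_0[of s ?x] dot_ge_0[of s "shift s ?x"] by simp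
    qed
  qed
qed

section \<open>Jordan type of the Jacobi operators\<close>

lemma independent_family:
  fixes f :: "nat \<Rightarrow> 'v :: real_vector"
  assumes 0: "\<forall>c. (\<Sum>i<n. c i *\<^sub>R f i) = 0 \<longrightarrow> (\<forall>i<n. c i = 0)"
  shows "inj_on f {..<n}" and "independent (f ` {..<n})"
proof -
  show inj: "inj_on f {..<n}"
  proof (rule inj_onI, rule ccontr)
    fix i j assume ij: "i \<in> {..<n}" "j \<in> {..<n}" "f i = f j" "i \<noteq> j"
    let ?c = "\<lambda>k. if k = i then 1 else if k = j then - 1 else 0 :: real"
    have "(\<Sum>k<n. ?c k *\<^sub>R f k) = (\<Sum>k\<in>{i, j}. ?c k *\<^sub>R f k)"
      by (rule sum.mono_neutral_right) (use ij in auto)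
    also have "\<dots> = 0"
      using ij by simp
    finally show False
      using spec[OF 0, of ?c] ij by auto
  qed
  show "independent (f ` {..<n})"
  proof (rule independent_if_scalars_zero)
    fix u x
    assume "(\<Sum>x\<in>f ` {..<n}. u x *\<^sub>R x) = 0" "x \<in> f ` {..<n}"
    then show "u x = 0"
      using spec[OF 0, of "\<lambda>i. u (f i)"] by (auto simp: sum.reindex[OF inj])
  qed simp
qed

lemma span_eq_of_card:
  fixes S B :: "'v :: real_vector set"
  assumes "independent S" "S \<subseteq> span B" "finite B" "card B \<le> card S"
  shows "span S = span B"
proof
  show "span S \<subseteq> span B"
    using assms(2) by (rule span_minimal[OF _ subspace_span])
  have "v \<in> span S" if "v \<in> span B" for v
  proof (rule ccontr)
    assume v: "v \<notin> span S"
    have ins: "independent (insert v S)" "insert v S \<subseteq> span B"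
      using independent_insertI[OF v assms(1)] assms(2) that by simp_all
    have "finite (insert v S) \<and> card (insert v S) \<le> card B"
      by (rule independent_span_bound[OF assms(3) ins])
    moreover have "v \<notin> S"
      using v span_superset by blast
    ultimately show False
      using assms(4) by auto
  qed
  then show "span B \<subseteq> span S"
    by blast
qed

lemma tangent_basis:
  assumes p: "p \<in> E n" and F: "\<And>i. i < n \<Longrightarrow> F i \<in> E n"
    and 0: "\<forall>c. (\<forall>k<n. (\<Sum>i<n. c i * F i k) = 0) \<longrightarrow> (\<forall>i<n. c i = 0)"
  defines "bs \<equiv> map (\<lambda>i. tvec n p (F i)) [0..<n]"
  shows "distinct bs" "independent (set bs)" "span (set bs) = T n p"
proof -
  let ?f = "\<lambda>i. tvec n p (F i)"
  have zero: "\<forall>c. (\<Sum>i<n. c i *\<^sub>R ?f i) = 0 \<longrightarrow> (\<forall>i<n. c i = 0)"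
  proof (intro allI impI, rule 0[rule_format])
    fix c i k assume c: "(\<Sum>i<n. c i *\<^sub>R ?f i) = 0" and k: "k < n"
    have "(\<Sum>i<m. c i *\<^sub>R F i) k = (\<Sum>i<m. c i * F i k)" for m
      by (induction m) (auto simp: scaleR_apply)
    moreover have "(\<Sum>i<n. c i *\<^sub>R ?f i) = tvec n p (\<Sum>i<n. c i *\<^sub>R F i)"
      by (simp add: linear_sum[OF tvec_linear] linear_scale[OF tvec_linear])
    moreover have "tvec n p (\<Sum>i<n. c i *\<^sub>R F i) (coord n k) = (\<Sum>i<n. c i *\<^sub>R F i) k"
      by (rule tvec_coord[OF p k])
    ultimately show "(\<Sum>i<n. c i * F i k) = 0"
      using c by simp
  qed
  note f = independent_family[where f = ?f, OF zero]
  have set: "set bs = ?f ` {..<n}"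
    by (auto simp: bs_def)
  show "distinct bs"
    using f(1) by (simp add: bs_def distinct_map lessThan_atLeast0)
  show "independent (set bs)"
    using f(2) by (simp add: set)
  have "T n p = span (tvec n p ` evec ` {..<n})"
    by (simp add: tangent_space_eq[OF p] E_span linear_span_image[OF tvec_linear])
  moreover have "?f ` {..<n} \<subseteq> T n p"
    using p by (auto intro: tvec_tangent)
  moreover have "card (tvec n p ` evec ` {..<n}) \<le> card (?f ` {..<n})"
    using card_image[OF f(1)] card_image_le[of "evec ` {..<n}" "tvec n p"]
      card_image_le[of "{..<n}" evec] by simp
  ultimately show "span (set bs) = T n p"
    unfolding set using span_eq_of_card[OF f(2)] by simp
qed

text \<open>
A matrix similar to \<open>0\<close> is \<open>0\<close>. Hence the zero operator does not share its Jordan form with a nonzero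
operator. The operators are only meaningful on \<open>V\<close>, so linearity is asked of an extension \<open>L\<close>.
\<close>

lemma jordan_form_zero:
  assumes "has_jordan_form V S n_as" "\<And>v. v \<in> V \<Longrightarrow> S v = 0"
    and "has_jordan_form V S' n_as" and L: "linear L" "\<And>v. v \<in> V \<Longrightarrow> S' v = L v"
    and v: "v \<in> V"
  shows "S' v = 0"
proof -
  obtain bs B where B: "distinct bs" "independent (set bs)" "span (set bs) = V"
    "B \<in> carrier_mat (length bs) (length bs)"
    "\<forall>j<length bs. S (bs ! j) = (\<Sum>i<length bs. (B $$ (i, j)) *\<^sub>R (bs ! i))"
    "jordan_nf (map_mat complex_of_real B) n_as"
    using assms(1) unfolding has_jordan_form_def by blast
  obtain bs' B' where B': "span (set bs') = V"
    "B' \<in> carrier_mat (length bs') (length bs')"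
    "\<forall>j<length bs'. S' (bs' ! j) = (\<Sum>i<length bs'. (B' $$ (i, j)) *\<^sub>R (bs' ! i))"
    "jordan_nf (map_mat complex_of_real B') n_as"
    using assms(3) unfolding has_jordan_form_def by blast
  have "B $$ (i, j) = 0" if ij: "i < length bs" "j < length bs" for i j
  proof -
    have nth: "bij_betw ((!) bs) {..<length bs} (set bs)"
      by (rule bij_betw_nth[OF B(1)]) auto
    define u where "u b = B $$ (inv_into {..<length bs} ((!) bs) b, j)" for b
    have u: "u (bs ! k) = B $$ (k, j)" if "k < length bs" for k
      using bij_betw_inv_into_left[OF nth, of k] that by (simp add: u_def)
    have "bs ! j \<in> V"
      using B(3) ij span_superset[of "set bs"] by auto
    then have "S (bs ! j) = 0"
      by (rule assms(2))
    moreover have "S (bs ! j) = (\<Sum>k<length bs. (B $$ (k, j)) *\<^sub>R (bs ! k))"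
      using B(5) ij(2) by blast
    ultimately have "0 = (\<Sum>k<length bs. (B $$ (k, j)) *\<^sub>R (bs ! k))"
      by (rule trans[OF sym])
    also have "\<dots> = (\<Sum>k<length bs. u (bs ! k) *\<^sub>R (bs ! k))"
      by (simp add: u)
    also have "\<dots> = (\<Sum>b\<in>set bs. u b *\<^sub>R b)"
      by (rule sum.reindex_bij_betw[OF nth])
    finally have "u (bs ! i) = 0"
      using independentD[OF B(2) finite_set subset_refl, of u "bs ! i"] ij by simp
    then show ?thesis
      using u ij by simp
  qed
  then have zero: "map_mat complex_of_real B = 0\<^sub>m (length bs) (length bs)"
    using B(4) by auto
  have "similar_mat (map_mat complex_of_real B') (jordan_matrix n_as)"
    "similar_mat (jordan_matrix n_as) (map_mat complex_of_real B)"
    using B(6) B'(4) by (auto simp: jordan_nf_def intro: similar_mat_sym)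
  then have "similar_mat (map_mat complex_of_real B') (map_mat complex_of_real B)"
    by (rule similar_mat_trans)
  from similar_matD[OF this] obtain n P Q where
    "{map_mat complex_of_real B', map_mat complex_of_real B, P, Q} \<subseteq> carrier_mat n n"
    and eq: "map_mat complex_of_real B' = P * map_mat complex_of_real B * Q"
    by (elim exE conjE)
  then have PQ: "map_mat complex_of_real B' \<in> carrier_mat n n"
    "map_mat complex_of_real B \<in> carrier_mat n n" "P \<in> carrier_mat n n" "Q \<in> carrier_mat n n"
    by simp_all
  then have n: "n = length bs" "n = length bs'"
    using PQ(1,2) B(4) B'(2) by auto
  have zero': "map_mat complex_of_real B' = 0\<^sub>m n n"
    using PQ(3,4) eq unfolding zero n(1)[symmetric] by simp
  have "B' $$ (i, j) = 0" if "i < length bs'" "j < length bs'" for i j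
  proof -
    have "complex_of_real (B' $$ (i, j)) = map_mat complex_of_real B' $$ (i, j)"
      using that B'(2) by simp
    then show ?thesis
      using that n(2) by (simp add: zero')
  qed
  then have "S' b = 0" if "b \<in> set bs'" for b
    using that B'(3) by (auto simp: in_set_conv_nth)
  then have "L b = 0" if "b \<in> set bs'" for b
    using that L(2) B'(1) span_superset[of "set bs'"] by force
  then have "L v = 0"
    using linear_eq_0_on_span[OF L(1)] v B'(1) by blast
  then show ?thesis
    using L(2)[OF v] by simp
qed

lemma jacobi_form_E: "jacobi_form s p x y \<in> E (3 * s)"
  by (simp add: jacobi_form_def blocks_E)

lemma jacobi_form_linear: "linear (jacobi_form s p x)"
  by (rule linearI)
    (auto simp: jacobi_form_def blocks_def fun_eq_iff scaleR_apply dot_plus_right dot_scaleR_right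
      shift_plus shift_scaleR algebra_simps)

lemma jacobi_form_self: "jacobi_form s p x x = 0"
  by (rule block_eqI[OF jacobi_form_E])
    (simp_all add: E_iff jacobi_form_def blocks_apply dot_commute)

text \<open>
The square retains the projection of the \<open>u\<close> part of \<open>y\<close> onto the complement of that of \<open>x\<close>, scaled and
moved to the \<open>v\<close> block; everything else in the \<open>v\<close> block of \<open>jacobi_form\<close> depends on the \<open>u\<close> block of the
argument, which is \<open>0\<close> after one application.
\<close>

lemma jacobi_form_square: "jacobi_form s p x (jacobi_form s p x y) = blocks s (\<lambda>i. 0) (\<lambda>i. 0)
    (\<lambda>i. dot s x x * (dot s x y * x i - dot s x x * y i))"
  by (rule block_eqI[OF jacobi_form_E blocks_E])
    (simp_all add: jacobi_form_def blocks_apply dot_blocks dot_linear dot_commute)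

lemma jacobi_form_third: "jacobi_form s p x (blocks s (\<lambda>i. 0) (\<lambda>i. 0) c) = 0"
  by (rule block_eqI[OF jacobi_form_E])
    (simp_all add: E_iff jacobi_form_def blocks_apply dot_blocks dot_linear)

lemma jacobi_form_cube: "jacobi_form s p x (jacobi_form s p x (jacobi_form s p x y)) = 0"
  by (simp add: jacobi_form_square[of s p x y] jacobi_form_third)

text \<open>
A vector \<open>a\<close> together with a basis of its orthogonal complement. Since \<open>a m \<noteq> 0\<close>, the vectors
\<open>a_m e_j - a_j e_m\<close> with \<open>j \<noteq> m\<close> form such a basis. Index \<open>0\<close> is reserved for \<open>a\<close> for every choice of \<open>m\<close>, by
means of the transposition \<open>\<tau>\<close> of \<open>0\<close> and \<open>m\<close>, so that the matrix below does not depend on \<open>m\<close>.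
\<close>

lemma orthogonal_family:
  assumes m: "m < s" "a m \<noteq> 0"
  obtains \<alpha> :: "nat \<Rightarrow> vect" where "\<And>k. \<alpha> 0 k = a k"
    "\<And>i. 0 < i \<Longrightarrow> i < s \<Longrightarrow> dot s a (\<alpha> i) = 0"
    "\<And>c i. (\<And>k. k < s \<Longrightarrow> (\<Sum>i<s. c i * \<alpha> i k) = 0) \<Longrightarrow> i < s \<Longrightarrow> c i = 0"
proof -
  define \<tau> where "\<tau> = (\<lambda>i. if i = 0 then m else if i = m then 0 else i)"
  define \<alpha> where "\<alpha> = (\<lambda>i. if i = 0 then a else (\<lambda>k. a m * evec (\<tau> i) k - a (\<tau> i) * evec m k))"
  have \<tau>: "\<tau> i < s" if "i < s" for i
    using that m by (auto simp: \<tau>_def)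
  have orth: "dot s a (\<alpha> i) = 0" if "0 < i" "i < s" for i
    using that m \<tau> by (simp add: \<alpha>_def dot_linear dot_unit)
  show ?thesis
  proof (rule that[of \<alpha>])
    show "\<alpha> 0 k = a k" for k
      by (simp add: \<alpha>_def)
    show "dot s a (\<alpha> i) = 0" if "0 < i" "i < s" for i
      using orth that .
    fix c i
    assume 0: "\<And>k. k < s \<Longrightarrow> (\<Sum>i<s. c i * \<alpha> i k) = 0" and i: "i < s"
    \<comment> \<open>Pairing a relation with \<open>a\<close> isolates the coefficient of \<open>a\<close> itself; the coordinate \<open>\<tau> i\<close> then
      isolates that of \<open>\<alpha> i\<close>.\<close>
    have "0 = (\<Sum>k<s. a k * (\<Sum>i<s. c i * \<alpha> i k))"
      using 0 by simp
    also have "\<dots> = (\<Sum>i<s. c i * dot s a (\<alpha> i))"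
      unfolding dot_def sum_distrib_left by (subst sum.swap) (simp add: algebra_simps)
    also have "\<dots> = (\<Sum>i\<in>{0}. c i * dot s a (\<alpha> i))"
      by (rule sum.mono_neutral_right) (use orth i in auto)
    finally have c0: "c 0 = 0"
      using dot_pos[of m s a] m by (simp add: \<alpha>_def)
    show "c i = 0"
    proof (cases "i = 0")
      case False
      have "0 = (\<Sum>j<s. c j * \<alpha> j (\<tau> i))"
        using 0[OF \<tau>[OF i]] by simp
      also have "\<dots> = (\<Sum>j\<in>{i}. c j * \<alpha> j (\<tau> i))"
        by (rule sum.mono_neutral_right) (use i c0 False in \<open>auto simp: \<alpha>_def \<tau>_def\<close>)
      finally show ?thesis
        using False m by (auto simp: \<alpha>_def \<tau>_def split: if_splits)
    qed (simp add: c0)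
  qed
qed

lemma sum_blocks: "(\<Sum>i<3 * s. h i) = (\<Sum>i<s. h i + h (s + i) + h (2 * s + i))"
  for h :: "nat \<Rightarrow> real"
proof -
  have "(\<Sum>i<k + s. h i) = (\<Sum>i<k. h i) + (\<Sum>i<s. h (k + i))" for k
    by (induction s) (simp_all add: add.assoc)
  from this[of "2 * s"] this[of s] show ?thesis
    by (simp add: sum.distrib mult_2 numeral_3_eq_3 add.assoc)
qed

text \<open>
A basis of \<open>3 * s\<close> vectors is ordered in three blocks of length \<open>s\<close>; the operator with this matrix moves
each vector one block further, except that it kills the last block and the zeroth vector of every block.
\<close>

definition shift_matrix :: "nat \<Rightarrow> real mat" where
  "shift_matrix s = mat (3 * s) (3 * s) (\<lambda>(i, j). if i = j + s \<and> j \<noteq> 0 \<and> j \<noteq> s then 1 else 0)"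

text \<open>
The basis consists of the chains \<open>\<alpha>_i\<close>, \<open>J \<alpha>_i\<close>, \<open>J (J \<alpha>_i)\<close> for \<open>0 < i < s\<close>, where \<open>\<alpha>_i\<close> is orthogonal to the \<open>u\<close>
part \<open>a\<close> of \<open>x\<close>, and of the kernel vectors \<open>x\<close>, \<open>(0, a, 0)\<close>, \<open>(0, 0, a)\<close> at the positions \<open>0\<close>, \<open>s\<close>, \<open>2 * s\<close>.
Independence is block triangular: in each of the three blocks the vectors are nonzero multiples of
\<open>a, \<alpha>_1, ..., \<alpha>_(s-1)\<close> modulo the preceding ones. The Jordan form \<open>n_as\<close> of the resulting matrix is
the same for all points and vectors, and its block sizes never have to be named.
\<close>

lemma jacobi_shift:
  assumes p: "p \<in> E (3 * s)" and x: "x \<in> T (3 * s) p"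
    and m: "m < s" "components (3 * s) x m \<noteq> 0"
    and nf: "jordan_nf (map_mat complex_of_real (shift_matrix s)) n_as"
  shows "has_jordan_form (T (3 * s) p) (jacobi (Rn (3 * s)) (metric s) p x) n_as"
proof -
  let ?n = "3 * s"
  define X where "X = components ?n x"
  have X: "X \<in> E ?n"
    by (simp add: X_def components_E)
  define N where "N = dot s X X"
  have N: "N \<noteq> 0"
    using dot_pos[of m s X] m by (simp add: N_def X_def)
  have m': "X m \<noteq> 0"
    using m by (simp add: X_def)
  obtain \<alpha> where \<alpha>: "\<And>k. \<alpha> 0 k = X k" "\<And>i. 0 < i \<Longrightarrow> i < s \<Longrightarrow> dot s X (\<alpha> i) = 0"
    "\<And>c i. (\<And>k. k < s \<Longrightarrow> (\<Sum>i<s. c i * \<alpha> i k) = 0) \<Longrightarrow> i < s \<Longrightarrow> c i = 0"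
    by (rule orthogonal_family[where m = m and s = s and a = X, OF m(1) m']) blast
  have s: "0 < s"
    using m by simp
  let ?o = "\<lambda>i. 0 :: real"
  define U where "U i = (if i = 0 then X else blocks s (\<alpha> i) ?o ?o)" for i
  define F where "F k = (if k < s then U k
     else if k < 2 * s then (if k = s then blocks s ?o X ?o else jacobi_form s p X (U (k - s)))
     else if k = 2 * s then blocks s ?o ?o X else jacobi_form s p X (jacobi_form s p X (U (k - 2 * s))))" for k
  have F1: "F i = U i" if "i < s" for i
    using that by (simp add: F_def)
  have F2: "F (s + i) = (if i = 0 then blocks s ?o X ?o else jacobi_form s p X (U i))" if "i < s" for i
    using that by (simp add: F_def)
  have F3: "F (2 * s + i) = (if i = 0 then blocks s ?o ?o X else jacobi_form s p X (jacobi_form s p X (U i)))" if "i < s" for i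
    using that by (simp add: F_def)
  have F_E: "F k \<in> E ?n" for k
    by (simp add: F_def U_def X jacobi_form_E blocks_E)
  have JF: "jacobi_form s p X (F k) = (if k < 2 * s \<and> k \<noteq> 0 \<and> k \<noteq> s then F (k + s) else 0)" if "k < ?n" for k
    using that
  proof (cases rule: block_cases)
    case (1 i)
    then show ?thesis
      using F1[of i] F2[of i] by (auto simp: U_def jacobi_form_self add.commute)
  next
    case (2 i)
    have "jacobi_form s p X (blocks s ?o X ?o) = 0"
      by (rule block_eqI[OF jacobi_form_E])
        (simp_all add: E_iff jacobi_form_def blocks_apply dot_blocks dot_linear)
    moreover have "F (s + i + s) = F (2 * s + i)"
      by (rule arg_cong[of _ _ F]) simp
    ultimately show ?thesis
      using 2 F2[of i] F3[of i] by auto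
  next
    case (3 i)
    then show ?thesis
      using F3[of i] by (auto simp: jacobi_form_third jacobi_form_cube)
  qed
  have entries:
    "F i k = \<alpha> i k" "F (s + i) k = 0" "F (2 * s + i) k = 0"
    "F (s + i) (s + k) = (if i = 0 then 1 else - N) * \<alpha> i k" "F (2 * s + i) (s + k) = 0"
    "F (2 * s + i) (2 * s + k) = (if i = 0 then 1 else - (N * N)) * \<alpha> i k"
    if "i < s" "k < s" for i k
  proof -
    show "F i k = \<alpha> i k"
      using that \<alpha>(1) by (simp add: F1 U_def blocks_apply)
    show "F (s + i) k = 0"
      using that by (simp add: F2 blocks_apply) (simp add: jacobi_form_def blocks_apply)
    show "F (2 * s + i) k = 0" "F (2 * s + i) (s + k) = 0"
      using that by (simp_all add: F3 blocks_apply jacobi_form_square)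
    show "F (s + i) (s + k) = (if i = 0 then 1 else - N) * \<alpha> i k"
      using that \<alpha>(1,2)
      by (simp add: F2 blocks_apply) (simp add: jacobi_form_def U_def blocks_apply dot_blocks N_def)
    show "F (2 * s + i) (2 * s + k) = (if i = 0 then 1 else - (N * N)) * \<alpha> i k"
      using that \<alpha>(1,2)
      by (simp add: F3 blocks_apply jacobi_form_square) (simp add: U_def blocks_apply dot_blocks N_def)
  qed
  have zero: "c i = 0" if c: "\<And>k. k < ?n \<Longrightarrow> (\<Sum>i<?n. c i * F i k) = 0" and i: "i < ?n" for c i
  proof -
    have c1: "c i = 0" if "i < s" for i
    proof (rule \<alpha>(3)[OF _ that])
      show "(\<Sum>i<s. c i * \<alpha> i k) = 0" if "k < s" for k
        using c[of k] that by (simp add: sum_blocks entries)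
    qed
    have c2: "c (s + i) = 0" if "i < s" for i
    proof -
      have "c (s + i) * (if i = 0 then 1 else - N) = 0"
      proof (rule \<alpha>(3)[OF _ that])
        show "(\<Sum>i<s. c (s + i) * (if i = 0 then 1 else - N) * \<alpha> i k) = 0" if "k < s" for k
          using c[of "s + k"] that by (simp add: sum_blocks entries c1 mult.assoc)
      qed
      then show ?thesis
        using N by (simp split: if_splits)
    qed
    have c3: "c (2 * s + i) = 0" if "i < s" for i
    proof -
      have "c (2 * s + i) * (if i = 0 then 1 else - (N * N)) = 0"
      proof (rule \<alpha>(3)[OF _ that])
        show "(\<Sum>i<s. c (2 * s + i) * (if i = 0 then 1 else - (N * N)) * \<alpha> i k) = 0" if "k < s" for k
          using c[of "2 * s + k"] that by (simp add: sum_blocks entries c1 c2 mult.assoc)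
      qed
      then show ?thesis
        using N by (simp split: if_splits)
    qed
    from i show ?thesis
      by (rule block_cases) (simp_all add: c1 c2 c3)
  qed
  let ?bs = "map (\<lambda>i. tvec ?n p (F i)) [0..<?n]"
  have zero': "\<forall>c. (\<forall>k<?n. (\<Sum>i<?n. c i * F i k) = 0) \<longrightarrow> (\<forall>i<?n. c i = 0)"
    using zero by blast
  note basis = tangent_basis[where F = F, OF p F_E zero']
  have "jacobi (Rn ?n) (metric s) p x (?bs ! j) =
      (\<Sum>i<length ?bs. (shift_matrix s $$ (i, j)) *\<^sub>R (?bs ! i))" if j: "j < length ?bs" for j
  proof -
    have j: "j < ?n"
      using j by simp
    have "jacobi (Rn ?n) (metric s) p x (?bs ! j) = tvec ?n p (jacobi_form s p X (F j))"
      using j p by (simp add: jacobi_metric[OF p x tvec_tangent[OF p]] components_tvec F_E X_def)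
    also have "jacobi_form s p X (F j) = (\<Sum>i<?n. (shift_matrix s $$ (i, j)) *\<^sub>R F i)"
    proof (cases "j < 2 * s \<and> j \<noteq> 0 \<and> j \<noteq> s")
      case True
      then have "(\<Sum>i<?n. (shift_matrix s $$ (i, j)) *\<^sub>R F i) =
          (\<Sum>i\<in>{j + s}. (shift_matrix s $$ (i, j)) *\<^sub>R F i)"
        using j by (intro sum.mono_neutral_right) (auto simp: shift_matrix_def)
      then show ?thesis
        using True j by (simp add: JF shift_matrix_def)
    next
      case False
      then show ?thesis
        using j by (subst sum.neutral) (auto simp: JF shift_matrix_def)
    qed
    finally show ?thesis
      using j by (simp add: linear_sum[OF tvec_linear] linear_scale[OF tvec_linear])
  qed
  then show ?thesis
    unfolding has_jordan_form_def using basis nf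
    by (intro exI[of _ ?bs] exI[of _ "shift_matrix s"]) (simp add: shift_matrix_def)
qed

lemma metric_spacelike_jordan_osserman: "spacelike_jordan_osserman (Rn (3 * s)) (metric s)"
proof -
  have C: "map_mat complex_of_real (shift_matrix s) \<in> carrier_mat (3 * s) (3 * s)"
    by (simp add: shift_matrix_def)
  obtain as where "char_poly (map_mat complex_of_real (shift_matrix s)) = (\<Prod>a\<leftarrow>as. [:- a, 1:])"
    using char_poly_factorized[OF C] by blast
  from jordan_nf_exists[OF C this]
  obtain n_as where nf: "jordan_nf (map_mat complex_of_real (shift_matrix s)) n_as"
    by blast
  have "has_jordan_form (T (3 * s) p) (jacobi (Rn (3 * s)) (metric s) p x) n_as"
    if p: "p \<in> E (3 * s)" and x: "x \<in> T (3 * s) p" and 1: "metric s p x x = 1" for p x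
  proof -
    have "\<exists>m<s. components (3 * s) x m \<noteq> 0"
    proof (rule ccontr)
      let ?x = "components (3 * s) x"
      assume "\<not> (\<exists>m<s. ?x m \<noteq> 0)"
      then have x: "dot s ?x y = 0" for y
        using dot_cong[of s ?x "\<lambda>i. 0" y y] by (simp add: dot_linear)
      then have "dot s y ?x = 0" for y
        by (simp add: dot_commute[of s y])
      with x have "metric s p x x = - dot s (shift s ?x) (shift s ?x)"
        by (simp add: metric_def metric_form_def)
      then show False
        using 1 dot_ge_0[of s "shift s ?x"] by simp
    qed
    then show ?thesis
      using jacobi_shift[OF p x _ _ nf] by blast
  qed
  then show ?thesis
    unfolding spacelike_jordan_osserman_def by auto
qed

section \<open>Nilpotency and timelike vectors\<close>

lemma jacobi_power:
  assumes p: "p \<in> E (3 * s)" and x: "x \<in> T (3 * s) p" and y: "y \<in> T (3 * s) p"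
  shows "(jacobi (Rn (3 * s)) (metric s) p x ^^ k) y =
    tvec (3 * s) p ((jacobi_form s p (components (3 * s) x) ^^ k) (components (3 * s) y))"
proof (induction k)
  case 0
  then show ?case
    using y p by (simp add: tvec_components)
next
  case (Suc k)
  have "(jacobi_form s p (components (3 * s) x) ^^ k) (components (3 * s) y) \<in> E (3 * s)"
    by (cases k) (simp_all add: components_E jacobi_form_E)
  then show ?case
    using p by (simp add: Suc jacobi_metric[OF p x tvec_tangent[OF p]] components_tvec)
qed

lemma jacobi_power_zero_3:
  assumes "p \<in> E (3 * s)" "x \<in> T (3 * s) p" "3 \<le> k"
  shows "jacobi_power_zero (Rn (3 * s)) (metric s) p x k"
  unfolding jacobi_power_zero_def
proof
  fix y assume y: "y \<in> T (3 * s) p"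
  let ?J = "jacobi_form s p (components (3 * s) x)"
  have "(?J ^^ (l + 3)) z = 0" for l z
  proof -
    have "(?J ^^ l) 0 = 0"
      by (induction l)
        (simp_all only: funpow.simps o_apply id_apply linear_0[OF jacobi_form_linear])
    moreover have "(?J ^^ 3) z = 0"
      by (simp add: numeral_3_eq_3 jacobi_form_cube)
    ultimately show ?thesis
      by (simp only: funpow_add o_apply)
  qed
  from this[of "k - 3"] show "(jacobi (Rn (3 * s)) (metric s) p x ^^ k) y = 0"
    using assms(3) by (simp add: jacobi_power[OF assms(1,2) y] linear_0[OF tvec_linear])
qed

text \<open>
Vanishing of a power persists for higher powers, so the index at which it starts is unique.
\<close>

lemma nilpotency_order_eq:
  assumes k: "jacobi_power_zero M g p x k" "\<not> jacobi_power_zero M g p x (k - 1)"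
    and 0: "jacobi M g p x 0 = 0"
  shows "nilpotency_order M g p x = k"
  unfolding nilpotency_order_def
proof (rule the_equality)
  have up: "jacobi_power_zero M g p x (i + l)" if "jacobi_power_zero M g p x i" for i l
  proof -
    have "(jacobi M g p x ^^ l) 0 = 0"
      by (induction l) (simp_all only: funpow.simps o_apply id_apply 0)
    then show ?thesis
      using that by (simp add: jacobi_power_zero_def add.commute[of i] funpow_add)
  qed
  show "0 < k \<and> jacobi_power_zero M g p x k \<and> \<not> jacobi_power_zero M g p x (k - 1)"
    using k by (cases k) auto
  fix l
  assume l: "0 < l \<and> jacobi_power_zero M g p x l \<and> \<not> jacobi_power_zero M g p x (l - 1)"
  show "l = k"
  proof (rule linorder_cases[of l k])
    assume "l < k"
    then show ?thesis
      using up[of l "k - 1 - l"] l k by simp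
  next
    assume "k < l"
    then show ?thesis
      using up[of k "l - 1 - k"] l k by simp
  qed
qed

lemma metric_tvec:
  "p \<in> E (3 * s) \<Longrightarrow> x \<in> E (3 * s) \<Longrightarrow> metric s p (tvec (3 * s) p x) (tvec (3 * s) p x) = metric_form s p x x"
  by (simp add: metric_def components_tvec)

lemma jacobi_tvec:
  assumes "p \<in> E (3 * s)" "x \<in> E (3 * s)" "y \<in> E (3 * s)"
  shows "jacobi (Rn (3 * s)) (metric s) p (tvec (3 * s) p x) (tvec (3 * s) p y) =
    tvec (3 * s) p (jacobi_form s p x y)"
  using assms by (simp add: jacobi_metric tvec_tangent components_tvec)

lemma tvec_eq_0:
  assumes "p \<in> E n" "tvec n p c = 0" "k < n"
  shows "c k = 0"
  using tvec_coord[OF assms(1,3), of c] assms(2) by simp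

text \<open>
The order never exceeds \<open>3\<close> since cubes vanish. It is attained at the origin by the first \<open>u\<close> direction,
whose squared Jacobi operator is nonzero on the second one; here \<open>s \<ge> 2\<close> is used.
\<close>

lemma metric_nilpotent_osserman:
  assumes s: "2 \<le> s"
  shows "nilpotent_osserman_of_order (Rn (3 * s)) (metric s) 3"
  unfolding nilpotent_osserman_of_order_def
proof
  let ?n = "3 * s" and ?M = "Rn (3 * s)" and ?g = "metric s"
  have zero: "0 \<in> T ?n p" for p
    by (auto simp: tangent_space_def)
  show "nilpotent_osserman ?M ?g"
    using s by (simp add: nilpotent_osserman_def jacobi_power_zero_3)
  have jacobi_0: "jacobi ?M ?g p x 0 = 0" if p: "p \<in> E ?n" and x: "x \<in> T ?n p" for p x
    using jacobi_metric[OF p x zero] linear_0[OF components_linear] linear_0[OF jacobi_form_linear]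
      linear_0[OF tvec_linear] by metis
  have order: "nilpotency_order ?M ?g p x \<le> 3"
    if p: "p \<in> E ?n" and x: "x \<in> T ?n p" for p x
  proof -
    let ?k = "LEAST k. jacobi_power_zero ?M ?g p x k"
    have 3: "jacobi_power_zero ?M ?g p x 3"
      by (rule jacobi_power_zero_3[OF p x order_refl])
    have k: "jacobi_power_zero ?M ?g p x ?k" "?k \<le> 3"
      using LeastI[of "jacobi_power_zero ?M ?g p x", OF 3]
        Least_le[of "jacobi_power_zero ?M ?g p x", OF 3] by auto
    have "\<not> jacobi_power_zero ?M ?g p x 0"
    proof
      assume "jacobi_power_zero ?M ?g p x 0"
      then have "tvec ?n p (evec 0) = 0"
        using tvec_tangent[OF p] by (simp add: jacobi_power_zero_def)
      then show False
        using tvec_eq_0[OF p, of "evec 0" 0] s by simp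
    qed
    then have "?k \<noteq> 0"
      using k(1) by metis
    then have k': "\<not> jacobi_power_zero ?M ?g p x (?k - 1)"
      using not_less_Least[of "?k - 1" "jacobi_power_zero ?M ?g p x"] by linarith
    have "nilpotency_order ?M ?g p x = ?k"
      by (rule nilpotency_order_eq[OF k(1) k' jacobi_0[OF p x]])
    then show ?thesis
      using k(2) by simp
  qed
  let ?S = "(\<lambda>(p, x). nilpotency_order ?M ?g p x) ` Sigma (points ?M) (T ?n)"
  have le: "k \<le> 3" if "k \<in> ?S" for k
    using that order by force
  have p: "0 \<in> E ?n"
    by (simp add: E_iff)
  define x where "x = tvec ?n 0 (evec 0)"
  have x: "x \<in> T ?n 0"
    unfolding x_def by (rule tvec_tangent[OF p])
  have e: "evec 0 \<in> E ?n" "evec 1 \<in> E ?n"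
    using s by (auto simp: E_iff)
  have "\<not> jacobi_power_zero ?M ?g 0 x 2"
  proof
    assume "jacobi_power_zero ?M ?g 0 x 2"
    then have "(jacobi ?M ?g 0 x ^^ 2) (tvec ?n 0 (evec 1)) = 0"
      using tvec_tangent[OF p] by (simp add: jacobi_power_zero_def)
    then have "tvec ?n 0 (jacobi_form s 0 (evec 0) (jacobi_form s 0 (evec 0) (evec 1))) = 0"
      by (simp add: numeral_2_eq_2 x_def jacobi_tvec p e jacobi_form_E del: One_nat_def)
    then have "jacobi_form s 0 (evec 0) (jacobi_form s 0 (evec 0) (evec 1)) (2 * s + 1) = 0"
      by (rule tvec_eq_0[OF p]) (use s in simp)
    moreover have "jacobi_form s 0 (evec 0) (jacobi_form s 0 (evec 0) (evec 1)) (2 * s + 1) = - 1"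
      using s blocks_apply(3)[of 1 s] by (simp add: jacobi_form_square dot_unit)
    ultimately show False
      by simp
  qed
  then have "nilpotency_order ?M ?g 0 x = 3"
    using jacobi_power_zero_3[OF p x order_refl] jacobi_0[OF p x]
    by (intro nilpotency_order_eq) simp_all
  then have "3 \<in> ?S"
    using p x by force
  then have "Sup ?S = 3"
    using le by (intro cSup_eq_maximum) auto
  then show "manifold_nilpotency_order ?M ?g = 3"
    by (simp add: manifold_nilpotency_order_def)
qed

text \<open>
At the origin the first \<open>t\<close> direction is timelike with Jacobi operator \<open>0\<close>. The timelike vector
\<open>e_0 - 1/2 e_(2s)\<close> has a nonzero \<open>u\<close> part, and its operator sends the second \<open>u\<close> direction to a vector with
a nonzero \<open>t\<close> part.
\<close>

lemma metric_not_timelike_jordan_osserman: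
  assumes s: "2 \<le> s"
  shows "\<not> timelike_jordan_osserman (Rn (3 * s)) (metric s)"
proof
  let ?n = "3 * s" and ?M = "Rn (3 * s)" and ?g = "metric s" and ?o = "\<lambda>i. 0 :: real"
  assume "timelike_jordan_osserman ?M ?g"
  then obtain n_as where form: "\<And>p x. p \<in> E ?n \<Longrightarrow> x \<in> T ?n p \<Longrightarrow> ?g p x x = - 1 \<Longrightarrow>
      has_jordan_form (T ?n p) (jacobi ?M ?g p x) n_as"
    unfolding timelike_jordan_osserman_def by auto
  have p: "0 \<in> E ?n"
    by (simp add: E_iff)
  define X where "X = blocks s ?o (evec 0) ?o"
  define r :: real where "r = - 1 / 2"
  define Y where "Y = blocks s (evec 0) ?o (\<lambda>i. r * evec 0 i)"
  have s': "0 < s" "1 < s"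
    using s by auto
  have sh0: "dot s 0 z = 0" for z
    by (simp add: dot_def)
  have XY: "X \<in> E ?n" "Y \<in> E ?n"
    by (simp_all add: X_def Y_def blocks_E)
  have "metric_form s 0 X X = - 1" "metric_form s 0 Y Y = - 1"
    using s'(1) by (simp_all add: metric_form_def X_def Y_def dot_blocks dot_linear dot_unit sh0)
      (simp add: r_def)
  then have forms: "has_jordan_form (T ?n 0) (jacobi ?M ?g 0 (tvec ?n 0 X)) n_as"
    "has_jordan_form (T ?n 0) (jacobi ?M ?g 0 (tvec ?n 0 Y)) n_as"
    using XY p by (auto intro!: form simp: tvec_tangent metric_tvec)
  have JX: "jacobi_form s 0 X z = 0" for z
    by (rule block_eqI[OF jacobi_form_E])
      (simp_all add: E_iff jacobi_form_def X_def blocks_apply dot_blocks dot_linear)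
  have e: "evec 1 \<in> E ?n"
    using s by (auto simp: E_iff)
  have "jacobi ?M ?g 0 (tvec ?n 0 Y) (tvec ?n 0 (evec 1)) = 0"
  proof (rule jordan_form_zero[OF forms(1) _ forms(2)])
    show "jacobi ?M ?g 0 (tvec ?n 0 X) v = 0" if "v \<in> T ?n 0" for v
      using XY p that
      by (simp add: jacobi_metric tvec_tangent components_tvec JX linear_0[OF tvec_linear])
    show "linear (\<lambda>v. tvec ?n 0 (jacobi_form s 0 Y (components ?n v)))"
      using linear_compose[OF linear_compose[OF components_linear jacobi_form_linear] tvec_linear]
      by (simp add: o_def)
    show "jacobi ?M ?g 0 (tvec ?n 0 Y) v = tvec ?n 0 (jacobi_form s 0 Y (components ?n v))" if "v \<in> T ?n 0" for v
      using XY p that by (simp add: jacobi_metric tvec_tangent components_tvec)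
  qed (rule tvec_tangent[OF p])
  then have "jacobi_form s 0 Y (evec 1) (s + 1) = 0"
    using tvec_eq_0[OF p, of "jacobi_form s 0 Y (evec 1)" "s + 1"] s'
    by (simp add: jacobi_tvec[OF p XY(2) e] del: One_nat_def)
  moreover have "jacobi_form s 0 Y (evec 1) (s + 1) = - 1"
    using s' blocks_apply(2)[of 1 s]
    by (simp add: jacobi_form_def Y_def dot_blocks dot_linear dot_unit blocks_apply)
  ultimately show False
    by simp
qed

theorem theorem1p1:
  fixes s :: nat
  assumes "2 \<le> s"
  shows "\<exists>(M :: (nat \<Rightarrow> real) manifold) g.
           pseudo_riemannian_manifold M g \<and> mdim M = 2 * s + s \<and> has_signature M g (2 * s, s) \<and>
           spacelike_jordan_osserman M g \<and>
           nilpotent_osserman_of_order M g 3 \<and>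
           \<not> timelike_jordan_osserman M g"
  using metric_pseudo_riemannian[of s] metric_signature[of s] metric_spacelike_jordan_osserman[of s]
    metric_nilpotent_osserman[OF assms] metric_not_timelike_jordan_osserman[OF assms]
  by (intro exI[of _ "Rn (3 * s)"] exI[of _ "metric s"]) simp

end
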